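(* For every integer $k \geq 2$, every graph $G$ with circumference at most $k$ has a colouring with at most $3\log_2 k$ colours such that every monochromatic component has order at most $k$.
   Context: All graphs are finite and simple. A $c$-colouring of a graph is an arbitrary assignment of one of $c$ colours to each vertex (adjacent vertices may receive the same colour). In a vertex-coloured graph, a monochromatic component is a connected component of the subgraph induced by all the vertices of one colour; its order is its number of vertices. The circumference of a graph $G$ is the length of a longest cycle in $G$ if $G$ contains a cycle, and is $2$ if $G$ is a forest. *)

theory Defs
  imports Complex_Main "Graph_Theory.Graph_Theory"
begin

text \<open>
  Finite simple undirected graphs are the library's \<^locale>\<open>graph\<close>: finite, loop-free
  digraphs without parallel arcs whose arc relation is symmetric. Each edge is thus represented
  by two opposite arcs, so \<^const>\<open>pre_digraph.cycle\<close> also holds of the closed walk of length 2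
  that traverses an edge back and forth. This walk is not a cycle of the undirected graph; for
  the same reason the library's \<^const>\<open>forest\<close> is not the undirected notion.
\<close>

definition graph_cycle :: "('a, 'b) pre_digraph \<Rightarrow> 'b list \<Rightarrow> bool" where
  "graph_cycle G p \<longleftrightarrow> pre_digraph.cycle G p \<and> 3 \<le> length p"

definition circumference :: "('a, 'b) pre_digraph \<Rightarrow> nat" where
  "circumference G =
    (if \<exists>p. graph_cycle G p then Max {length p | p. graph_cycle G p} else 2)"

definition colouring :: "('a, 'b) pre_digraph \<Rightarrow> nat \<Rightarrow> ('a \<Rightarrow> nat) \<Rightarrow> bool" where
  "colouring G c f \<longleftrightarrow> (\<forall>v \<in> verts G. f v < c)"

definition graph_component :: "('a, 'b) pre_digraph \<Rightarrow> ('a, 'b) pre_digraph \<Rightarrow> bool" where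
  "graph_component H G \<longleftrightarrow> pre_digraph.max_subgraph G Digraph_Component.connected H"

definition monochromatic_component ::
    "('a, 'b) pre_digraph \<Rightarrow> ('a \<Rightarrow> nat) \<Rightarrow> ('a, 'b) pre_digraph \<Rightarrow> bool" where
  "monochromatic_component G f H \<longleftrightarrow>
    (\<exists>i. graph_component H (G \<restriction> {v \<in> verts G. f v = i}))"

end

theory Submission
  imports Defs
begin

text \<open>
  Strengthen the claim so that any colouring of a clique \<open>P\<close> of at most two vertices can be extended
  with no vertex outside \<open>P\<close> sharing the colour of a neighbour in \<open>P\<close>. Along a separation of order at
  most two, one colours one side and then extends from the separator to the other side; if the
  separator is a nonadjacent pair, an edge is added to it on both sides, which is harmless because a
  path through the other side replaces it in any cycle. If there is no such separation and at least
  four vertices, let \<open>C\<close> be a longest cycle. By Menger's theorem three disjoint paths join \<open>C\<close> to any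
  cycle disjoint from it, and rerouting along pairs of these paths shows that the second cycle has at
  most half the length of \<open>C\<close>. So \<open>C\<close> receives one colour, \<open>P\<close> keeps its at most two, and the rest,
  whose circumference is at most \<open>k div 2\<close>, is coloured by induction with three colours fewer.
\<close>

text \<open>Colouring a longest cycle and recursing does not work by itself: in a disconnected
  graph, for example, a disjoint cycle may be as long as \<open>C\<close>. Hence the detour through
  separations of order at most two, which dictates the form of the strengthened claim.
  \<open>P\<close> is a clique so that it lies on one side of every separation; its colours are
  arbitrary because those of a separator are prescribed by the side coloured first; its order is at
  most two because such separators take its place in the recursion. The price is up to two colours
  for \<open>P\<close> besides the one for \<open>C\<close>, and this is the factor 3 of the
  logarithm: as \<open>8 * (k div 2)^3 <= k^3\<close>, the condition \<open>k^3 < 2^(c + 1)\<close>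
  survives halving \<open>k\<close> and giving up three colours. Small \<open>k\<close> need no base
  case, since minimum degree three forces a cycle of length at least four, so that
  \<open>k div 2\<close> is at least 2 whenever \<open>k\<close> is halved.\<close>

section \<open>Connected sets and Menger's theorem\<close>

text \<open>Connectedness in terms of cuts rather than paths; the empty set counts as connected.\<close>

definition conn_set :: "('a \<times> 'a) set \<Rightarrow> 'a set \<Rightarrow> bool" where
  "conn_set E W \<longleftrightarrow>
    (\<forall>D. D \<inter> W \<noteq> {} \<longrightarrow> (\<forall>u \<in> D \<inter> W. \<forall>v \<in> W. (u, v) \<in> E \<longrightarrow> v \<in> D) \<longrightarrow> W \<subseteq> D)"

lemma conn_setI:
  assumes "\<And>D. \<lbrakk>D \<inter> W \<noteq> {}; \<And>u v. \<lbrakk>u \<in> D; u \<in> W; v \<in> W; (u, v) \<in> E\<rbrakk> \<Longrightarrow> v \<in> D\<rbrakk> \<Longrightarrow> W \<subseteq> D"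
  shows "conn_set E W"
  using assms unfolding conn_set_def by blast

lemma conn_setD:
  assumes "conn_set E W" "a \<in> D" "a \<in> W"
    and "\<And>u v. \<lbrakk>u \<in> D; u \<in> W; v \<in> W; (u, v) \<in> E\<rbrakk> \<Longrightarrow> v \<in> D"
  shows "W \<subseteq> D"
  using assms unfolding conn_set_def by blast

lemma conn_set_crossing:
  assumes "conn_set E W" "a \<in> W" "a \<in> D" "b \<in> W" "b \<notin> D"
  obtains u v where "u \<in> W" "u \<in> D" "v \<in> W" "v \<notin> D" "(u, v) \<in> E"
proof (rule ccontr)
  assume "\<not> thesis"
  then have "W \<subseteq> D" using that by (intro conn_setD[OF assms(1,3,2)]) blast
  then show False using assms(4,5) by auto
qed

lemma conn_set_singleton [simp]: "conn_set E {a}"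
  by (rule conn_setI) auto

lemma conn_set_mono: "conn_set E W \<Longrightarrow> E \<inter> W \<times> W \<subseteq> E' \<Longrightarrow> conn_set E' W"
  unfolding conn_set_def by blast

lemma conn_set_Un:
  assumes "conn_set E U" "conn_set E W" "z \<in> U" "z \<in> W"
  shows "conn_set E (U \<union> W)"
proof (rule conn_setI)
  fix D assume D: "D \<inter> (U \<union> W) \<noteq> {}"
    and cl: "\<And>u v. \<lbrakk>u \<in> D; u \<in> U \<union> W; v \<in> U \<union> W; (u, v) \<in> E\<rbrakk> \<Longrightarrow> v \<in> D"
  have U: "U \<subseteq> D" if "a \<in> D" "a \<in> U" for a
    by (rule conn_setD[OF assms(1) that]) (auto intro: cl)
  have W: "W \<subseteq> D" if "a \<in> D" "a \<in> W" for a
    by (rule conn_setD[OF assms(2) that]) (auto intro: cl)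
  show "U \<union> W \<subseteq> D" using D U W assms(3,4) by blast
qed

lemma conn_set_edge:
  assumes "(x, y) \<in> E" "(y, x) \<in> E"
  shows "conn_set E {x, y}"
  by (rule conn_setI) (use assms in auto)

lemma conn_set_join:
  assumes "sym E" "conn_set E U" "conn_set E W" "x \<in> U" "y \<in> W" "(x, y) \<in> E"
  shows "conn_set E (U \<union> W)"
proof -
  have "conn_set E (U \<union> {x, y})"
    using assms by (intro conn_set_Un[where z=x] conn_set_edge) (auto dest: symD)
  then have "conn_set E ((U \<union> {x, y}) \<union> W)"
    using assms by (intro conn_set_Un[of E "U \<union> {x, y}" W y]) auto
  moreover have "(U \<union> {x, y}) \<union> W = U \<union> W" using assms by auto
  ultimately show ?thesis by simp
qed

section \<open>Components of induced subgraphs\<close>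

definition component_in :: "('a \<times> 'a) set \<Rightarrow> 'a set \<Rightarrow> 'a \<Rightarrow> 'a set" where
  "component_in E W a = \<Union>{U. U \<subseteq> W \<and> conn_set E U \<and> a \<in> U}"

lemma component_in_subset: "component_in E W a \<subseteq> W"
  by (auto simp: component_in_def)

lemma component_in_self: "a \<in> W \<Longrightarrow> a \<in> component_in E W a"
  unfolding component_in_def by (auto intro!: exI[of _ "{a}"])

lemma component_in_upper: "\<lbrakk>U \<subseteq> W; conn_set E U; a \<in> U\<rbrakk> \<Longrightarrow> U \<subseteq> component_in E W a"
  by (auto simp: component_in_def)

lemma conn_set_component_in: "conn_set E (component_in E W a)"
proof (rule conn_setI)
  fix D assume D: "D \<inter> component_in E W a \<noteq> {}"
    and cl: "\<And>u v. \<lbrakk>u \<in> D; u \<in> component_in E W a; v \<in> component_in E W a; (u, v) \<in> E\<rbrakk> \<Longrightarrow> v \<in> D"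
  have *: "U \<subseteq> D" if "U \<subseteq> W" "conn_set E U" "a \<in> U" "b \<in> U" "b \<in> D" for U b
    using that component_in_upper[of U W E a] by (intro conn_setD[of E U b D]) (auto intro: cl)
  from D have "a \<in> D" using * unfolding component_in_def by blast
  then show "component_in E W a \<subseteq> D" using * unfolding component_in_def by blast
qed

lemma component_in_closed:
  assumes "sym E" "u \<in> component_in E W a" "v \<in> W" "(u, v) \<in> E"
  shows "v \<in> component_in E W a"
proof -
  obtain U where U: "U \<subseteq> W" "conn_set E U" "a \<in> U" "u \<in> U"
    using assms(2) unfolding component_in_def by auto
  have "conn_set E (U \<union> {v})"
    using U assms by (intro conn_set_join[where x=u and y=v]) auto
  then show ?thesis using U assms(3) component_in_upper[of "U \<union> {v}" W E a] by auto
qed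

section \<open>Separators and linkages\<close>

text \<open>A single vertex is a connected set, so a separator contains all of
  \<open>A \<inter> B\<close>; it may also use other vertices of \<open>A\<close> and
  \<open>B\<close>, as in the vertex form of Menger's theorem.\<close>

definition separates :: "('a \<times> 'a) set \<Rightarrow> 'a set \<Rightarrow> 'a set \<Rightarrow> 'a set \<Rightarrow> bool" where
  "separates E A B X \<longleftrightarrow>
    (\<forall>W. conn_set E W \<longrightarrow> W \<inter> A \<noteq> {} \<longrightarrow> W \<inter> B \<noteq> {} \<longrightarrow> W \<inter> X \<noteq> {})"

lemma separates_commute: "separates E A B X \<longleftrightarrow> separates E B A X"
  unfolding separates_def by blast

definition linked :: "('a \<times> 'a) set \<Rightarrow> 'a set \<Rightarrow> 'a set \<Rightarrow> nat \<Rightarrow> bool" where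
  "linked E A B n \<longleftrightarrow> (\<exists>F. disjoint_family_on F {..<n} \<and>
    (\<forall>i<n. conn_set E (F i) \<and> F i \<inter> A \<noteq> {} \<and> F i \<inter> B \<noteq> {}))"

lemma linked_mono: "linked E A B n \<Longrightarrow> E \<subseteq> E' \<Longrightarrow> linked E' A B n"
  unfolding linked_def using conn_set_mono by (metis Int_lower1 order_trans)

lemma linkedI:
  assumes "finite I" "card I = n" "disjoint_family_on F I"
    and "\<And>i. i \<in> I \<Longrightarrow> conn_set E (F i) \<and> F i \<inter> A \<noteq> {} \<and> F i \<inter> B \<noteq> {}"
  shows "linked E A B n"
proof -
  obtain h where h: "bij_betw h {..<n} I"
    using ex_bij_betw_nat_finite[OF assms(1)] assms(2) by (auto simp: atLeast0LessThan)
  have "disjoint_family_on (F \<circ> h) {..<n}"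
    using h assms(3) unfolding disjoint_family_on_def bij_betw_def inj_on_def by auto
  moreover have "\<forall>i<n. conn_set E ((F \<circ> h) i) \<and> (F \<circ> h) i \<inter> A \<noteq> {} \<and> (F \<circ> h) i \<inter> B \<noteq> {}"
    using h assms(4) unfolding bij_betw_def by auto
  ultimately show ?thesis unfolding linked_def by blast
qed

text \<open>\<open>D\<close> is the component in \<open>W - P\<close> of a vertex of
  \<open>A\<close>. Connectedness of \<open>W\<close> yields an edge leaving \<open>D\<close>, whose
  far end \<open>p\<close> can only lie in \<open>P\<close>. \<open>D\<close> is empty if the chosen
  vertex of \<open>A\<close> is itself in \<open>P\<close>.\<close>

lemma conn_set_trim:
  assumes "sym E" "conn_set E W" "W \<inter> A \<noteq> {}" "W \<inter> P \<noteq> {}"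
  obtains p D where "insert p D \<subseteq> W" "p \<in> P" "D \<inter> P = {}" "conn_set E (insert p D)" "conn_set E D"
    "insert p D \<inter> A \<noteq> {}" "D = {} \<or> D \<inter> A \<noteq> {}"
proof -
  obtain a where a: "a \<in> W" "a \<in> A" using assms(3) by auto
  show thesis
  proof (cases "a \<in> P")
    case True
    then show thesis using a by (intro that[of a "{}"]) (auto simp: conn_set_def)
  next
    case False
    define D where "D = component_in E (W - P) a"
    have aD: "a \<in> D" unfolding D_def using a False by (intro component_in_self) auto
    have DP: "D \<subseteq> W - P" unfolding D_def by (rule component_in_subset)
    obtain b where b: "b \<in> W" "b \<in> P" using assms(4) by auto
    obtain u p where up: "u \<in> W" "u \<in> D" "p \<in> W" "p \<notin> D" "(u, p) \<in> E"
      using conn_set_crossing[OF assms(2) a(1) aD b(1)] b DP by blast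
    have "p \<in> P"
      using up component_in_closed[OF assms(1), of u "W - P" a p] unfolding D_def by auto
    have cD: "conn_set E D" unfolding D_def by (rule conn_set_component_in)
    moreover have "conn_set E (insert p D)"
      using conn_set_join[OF assms(1) cD conn_set_singleton[of E p], of u p] up by simp
    ultimately show thesis using \<open>p \<in> P\<close> a aD DP up by (intro that[of p D]) auto
  qed
qed

text \<open>After trimming, each of the \<open>n\<close> disjoint sets meets \<open>P\<close> in one
  vertex, so all \<open>n\<close> vertices of \<open>P\<close> occur and the sets can be indexed by
  \<open>P\<close>. The last conclusion says that vertices other than \<open>p\<close> are reached
  from \<open>A\<close> without touching \<open>P\<close>; \<open>menger\<close> needs it to keep
  its two families apart.\<close>

lemma linked_onto:
  assumes "sym E" "linked E A P n" "finite P" "card P = n"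
  obtains F where "disjoint_family_on F P"
    "\<And>p. p \<in> P \<Longrightarrow> conn_set E (F p) \<and> F p \<inter> A \<noteq> {} \<and> F p \<inter> P = {p}"
    "\<And>p v. \<lbrakk>p \<in> P; v \<in> F p; v \<noteq> p\<rbrakk> \<Longrightarrow> \<exists>U. conn_set E U \<and> v \<in> U \<and> U \<inter> P = {} \<and> U \<inter> A \<noteq> {}"
proof -
  obtain F where F: "disjoint_family_on F {..<n}"
    "\<And>i. i < n \<Longrightarrow> conn_set E (F i) \<and> F i \<inter> A \<noteq> {} \<and> F i \<inter> P \<noteq> {}"
    using assms(2) unfolding linked_def by blast
  have "\<exists>q D. insert q D \<subseteq> F i \<and> q \<in> P \<and> D \<inter> P = {} \<and> conn_set E (insert q D) \<and> conn_set E D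
      \<and> insert q D \<inter> A \<noteq> {} \<and> (D = {} \<or> D \<inter> A \<noteq> {})" if "i < n" for i
    using F(2)[OF that] conn_set_trim[OF assms(1), of "F i" A P] by metis
  then obtain q D where qD: "\<And>i. i < n \<Longrightarrow> insert (q i) (D i) \<subseteq> F i \<and> q i \<in> P \<and> D i \<inter> P = {}
      \<and> conn_set E (insert (q i) (D i)) \<and> conn_set E (D i)
      \<and> insert (q i) (D i) \<inter> A \<noteq> {} \<and> (D i = {} \<or> D i \<inter> A \<noteq> {})"
    by metis
  have disj: "F i \<inter> F j = {}" if "i < n" "j < n" "i \<noteq> j" for i j
    using F(1) that unfolding disjoint_family_on_def by auto
  have inj: "inj_on q {..<n}"
  proof (rule inj_onI, rule ccontr)
    fix i j assume ij: "i \<in> {..<n}" "j \<in> {..<n}" "q i = q j" "i \<noteq> j"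
    then have "q i \<in> F i" "q i \<in> F j" using qD[of i] qD[of j] by auto
    then show False using disj ij by auto
  qed
  have "q ` {..<n} \<subseteq> P" using qD by auto
  then have onto: "q ` {..<n} = P"
    using assms(3,4) card_image[OF inj] by (intro card_subset_eq) auto
  define r where "r = the_inv_into {..<n} q"
  have r: "r p < n" "q (r p) = p" if "p \<in> P" for p
    using that the_inv_into_into[OF inj, of p "{..<n}"] f_the_inv_into_f[OF inj, of p]
    unfolding r_def onto by auto
  show thesis
  proof (rule that[of "\<lambda>p. insert p (D (r p))"])
    have "insert p (D (r p)) \<inter> insert p' (D (r p')) = {}" if "p \<in> P" "p' \<in> P" "p \<noteq> p'" for p p'
    proof -
      have "r p \<noteq> r p'" using that r by metis
      then show ?thesis using disj[of "r p" "r p'"] qD[of "r p"] qD[of "r p'"] r that by auto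
    qed
    then show "disjoint_family_on (\<lambda>p. insert p (D (r p))) P"
      unfolding disjoint_family_on_def by blast
    show "conn_set E (insert p (D (r p))) \<and> insert p (D (r p)) \<inter> A \<noteq> {} \<and> insert p (D (r p)) \<inter> P = {p}"
      if "p \<in> P" for p
      using qD[OF r(1)[OF that]] unfolding r(2)[OF that] by auto
    show "\<exists>U. conn_set E U \<and> v \<in> U \<and> U \<inter> P = {} \<and> U \<inter> A \<noteq> {}"
      if "p \<in> P" "v \<in> insert p (D (r p))" "v \<noteq> p" for p v
    proof -
      have "v \<in> D (r p)" using that by auto
      then show ?thesis using qD[OF r(1)[OF that(1)]] by blast
    qed
  qed
qed

text \<open>A set that starts in \<open>A\<close> and avoids \<open>Z\<close> does not reach
  \<open>x\<close> or \<open>X\<close> in \<open>E'\<close>, and then not \<open>y\<close> either.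
  So the edge between \<open>x\<close> and \<open>y\<close> cannot enlarge it: it is connected
  already in \<open>E'\<close>, where \<open>X\<close> keeps it away from \<open>B\<close>.\<close>

lemma separates_lift:
  assumes "sym E'" "E \<subseteq> E' \<union> {(x, y), (y, x)}"
    and X: "separates E' A B X"
    and y: "\<And>U. \<lbrakk>conn_set E' U; U \<inter> A \<noteq> {}; U \<inter> X = {}\<rbrakk> \<Longrightarrow> y \<notin> U"
    and Z: "separates E' A (insert x X) Z"
  shows "separates E A B Z"
  unfolding separates_def
proof (intro allI impI notI)
  fix W assume W: "conn_set E W" "W \<inter> A \<noteq> {}" "W \<inter> B \<noteq> {}" "W \<inter> Z = {}"
  obtain a where a: "a \<in> W" "a \<in> A" using W by auto
  define D where "D = component_in E' W a"
  have cD: "conn_set E' D" unfolding D_def by (rule conn_set_component_in)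
  have DW: "D \<subseteq> W" unfolding D_def by (rule component_in_subset)
  have aD: "a \<in> D" unfolding D_def using a by (intro component_in_self)
  have DX: "D \<inter> insert x X = {}"
    using Z cD aD a DW W(4) unfolding separates_def by blast
  then have yD: "y \<notin> D" using y[OF cD] a aD by auto
  have "W \<subseteq> D"
  proof (rule conn_setD[OF W(1) aD a(1)])
    fix u v assume "u \<in> D" "u \<in> W" "v \<in> W" "(u, v) \<in> E"
    then show "v \<in> D"
      using component_in_closed[OF assms(1), of u W a v] assms(2) DX yD unfolding D_def by auto
  qed
  then have "W = D" using DW by auto
  then show False using X cD W DX unfolding separates_def by blast
qed

text \<open>Menger's theorem in Goering's edge-deletion proof. Disjoint connected sets meeting both sides
  replace disjoint paths, so that concatenating paths becomes taking unions.\<close>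

lemma menger:
  assumes "finite E" "sym E" "finite A" "finite B"
    and "\<And>X. finite X \<Longrightarrow> separates E A B X \<Longrightarrow> n \<le> card X"
  shows "linked E A B n"
  using assms
proof (induction "card E" arbitrary: E A B rule: less_induct)
  case less
  note sep = less.prems(5)
  show ?case
  proof (cases "E = {}")
    case True
    have "separates E A B (A \<inter> B)" unfolding separates_def
    proof (intro allI impI)
      fix W assume W: "conn_set E W" "W \<inter> A \<noteq> {}" "W \<inter> B \<noteq> {}"
      then obtain a where a: "a \<in> W" "a \<in> A" by auto
      have "W \<subseteq> {a}" using conn_setD[OF W(1), of a "{a}"] a True by auto
      then show "W \<inter> (A \<inter> B) \<noteq> {}" using W a by auto
    qed
    then have "n \<le> card (A \<inter> B)" using sep less.prems by auto
    then obtain I where I: "I \<subseteq> A \<inter> B" "card I = n" "finite I"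
      using obtain_subset_with_card_n by metis
    show ?thesis
      by (rule linkedI[OF I(3,2), of "\<lambda>i. {i}"]) (use I in \<open>auto simp: disjoint_family_on_def\<close>)
  next
    case False
    then obtain x0 y0 where xy0: "(x0, y0) \<in> E" by auto
    define E' where "E' = E - {(x0, y0), (y0, x0)}"
    have E'E: "E' \<subseteq> E" and symE': "sym E'" and finE': "finite E'"
      using less.prems unfolding E'_def sym_def by auto
    have "card E' < card E"
      using xy0 less.prems(1) unfolding E'_def by (intro psubset_card_mono) auto
    note IH = less.hyps[OF this finE' symE']
    show ?thesis
    proof (cases "\<forall>X. finite X \<longrightarrow> separates E' A B X \<longrightarrow> n \<le> card X")
      case True
      then show ?thesis using IH[OF less.prems(3,4)] linked_mono[OF _ E'E] by blast
    next
      case False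
      then obtain X where X: "finite X" "separates E' A B X" "card X < n" by force
      have "\<not> separates E A B X" using sep X by force
      then obtain W where W: "conn_set E W" "W \<inter> A \<noteq> {}" "W \<inter> B \<noteq> {}" "W \<inter> X = {}"
        unfolding separates_def by auto
      define RA where "RA = \<Union>{U. conn_set E' U \<and> U \<inter> A \<noteq> {} \<and> U \<inter> X = {}}"
      obtain a b where ab: "a \<in> W" "a \<in> A" "b \<in> W" "b \<in> B" using W by auto
      have aRA: "a \<in> RA" unfolding RA_def
        using ab W(4) by (auto intro!: exI[of _ "{a}"])
      have disjR: "U \<inter> RA = {}" if "conn_set E' U" "U \<inter> B \<noteq> {}" "U \<inter> X = {}" for U
      proof (rule ccontr)
        assume "U \<inter> RA \<noteq> {}"
        then obtain z U' where z: "z \<in> U" "z \<in> U'" "conn_set E' U'" "U' \<inter> A \<noteq> {}" "U' \<inter> X = {}"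
          unfolding RA_def by auto
        then have "conn_set E' (U \<union> U')" using that by (intro conn_set_Un)
        then show False using X(2) z that unfolding separates_def by blast
      qed
      have "b \<notin> RA" using disjR[of "{b}"] ab W(4) by auto
      then obtain x y where xy: "x \<in> W" "x \<in> RA" "y \<in> W" "y \<notin> RA" "(x, y) \<in> E"
        using conn_set_crossing[OF W(1) ab(1) aRA ab(3)] by blast
      \<comment> \<open>An edge of \<open>E'\<close> would extend the set that reaches
        \<open>x\<close> to \<open>y\<close>. So the edge leaving \<open>RA\<close> is the deleted
        one, oriented with \<open>x\<close> on the side of \<open>A\<close>.\<close>
      have "(x, y) \<notin> E'"
      proof
        assume e: "(x, y) \<in> E'"
        obtain U where U: "x \<in> U" "conn_set E' U" "U \<inter> A \<noteq> {}" "U \<inter> X = {}"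
          using xy(2) unfolding RA_def by auto
        have "conn_set E' (U \<union> {y})"
          using U e symE' by (intro conn_set_join[where x=x and y=y]) auto
        then show False using U xy(3,4) W(4) unfolding RA_def by blast
      qed
      then have EE': "E \<subseteq> E' \<union> {(x, y), (y, x)}" "E \<subseteq> E' \<union> {(y, x), (x, y)}" "x \<noteq> y"
        using xy unfolding E'_def by auto
      have xX: "x \<notin> X" and yX: "y \<notin> X" using xy W by auto
      define P Q where "P = insert x X" and "Q = insert y X"
      have avoid_sep: "separates E A B (insert z X)" if "z = x \<or> z = y" for z
        unfolding separates_def
      proof (intro allI impI notI)
        fix W assume W: "conn_set E W" "W \<inter> A \<noteq> {}" "W \<inter> B \<noteq> {}" "W \<inter> insert z X = {}"
        have "conn_set E' W" using W(1) by (rule conn_set_mono) (use that W(4) EE' in auto)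
        then show False using X W unfolding separates_def by blast
      qed
      \<comment> \<open>\<open>X\<close> has fewer than \<open>n\<close> vertices, yet together with
        either end of the deleted edge it separates \<open>A\<close> from \<open>B\<close> in
        \<open>E\<close>; so it has exactly \<open>n - 1\<close>.\<close>
      have "n \<le> card P" using sep avoid_sep X unfolding P_def by auto
      then have cP: "card P = n" and cQ: "card Q = n" and fP: "finite P" and fQ: "finite Q"
        using X xX yX unfolding P_def Q_def by auto
      have yU: "y \<notin> U" if "conn_set E' U" "U \<inter> A \<noteq> {}" "U \<inter> X = {}" for U
        using that xy(4) unfolding RA_def by auto
      have xU: "x \<notin> U" if "conn_set E' U" "U \<inter> B \<noteq> {}" "U \<inter> X = {}" for U
        using disjR[OF that] xy(2) by auto
      have "linked E' A P n"
      proof (rule IH[OF less.prems(3) fP])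
        fix Z assume Z: "finite Z" "separates E' A P Z"
        have "separates E A B Z"
          by (rule separates_lift[OF symE' EE'(1) X(2)]) (use yU Z(2) in \<open>auto simp: P_def\<close>)
        then show "n \<le> card Z" by (rule sep[OF Z(1)])
      qed
      then obtain F where F: "disjoint_family_on F P"
        "\<And>p. p \<in> P \<Longrightarrow> conn_set E' (F p) \<and> F p \<inter> A \<noteq> {} \<and> F p \<inter> P = {p}"
        "\<And>p v. \<lbrakk>p \<in> P; v \<in> F p; v \<noteq> p\<rbrakk> \<Longrightarrow> \<exists>U. conn_set E' U \<and> v \<in> U \<and> U \<inter> P = {} \<and> U \<inter> A \<noteq> {}"
        using linked_onto[OF symE' _ fP cP] by blast
      have X': "separates E' B A X" using X(2) separates_commute by blast
      have "linked E' B Q n"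
      proof (rule IH[OF less.prems(4) fQ])
        fix Z assume Z: "finite Z" "separates E' B Q Z"
        have "separates E B A Z"
          by (rule separates_lift[OF symE' EE'(2) X']) (use xU Z(2) in \<open>auto simp: Q_def\<close>)
        then have "separates E A B Z" using separates_commute by blast
        then show "n \<le> card Z" by (rule sep[OF Z(1)])
      qed
      then obtain G where G: "disjoint_family_on G Q"
        "\<And>p. p \<in> Q \<Longrightarrow> conn_set E' (G p) \<and> G p \<inter> B \<noteq> {} \<and> G p \<inter> Q = {p}"
        "\<And>p v. \<lbrakk>p \<in> Q; v \<in> G p; v \<noteq> p\<rbrakk> \<Longrightarrow> \<exists>U. conn_set E' U \<and> v \<in> U \<and> U \<inter> Q = {} \<and> U \<inter> B \<noteq> {}"
        using linked_onto[OF symE' _ fQ cQ] by blast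
      \<comment> \<open>Outside \<open>X\<close> the sets of \<open>F\<close> lie in
        \<open>RA\<close> and those of \<open>G\<close> avoid it. A common vertex is therefore in
        \<open>X\<close>, where each set contains at most its own index.\<close>
      have FG: "v = p \<and> v = q \<and> v \<in> X" if "p \<in> P" "q \<in> Q" "v \<in> F p" "v \<in> G q" for p q v
      proof (cases "v \<in> X")
        case True
        then show ?thesis using F(2)[OF that(1)] G(2)[OF that(2)] that unfolding P_def Q_def by auto
      next
        case False
        have "v \<in> RA"
        proof (cases "v = p")
          case True
          then show ?thesis using that False xy unfolding P_def by auto
        next
          case False
          then show ?thesis using F(3)[OF that(1,3)] unfolding RA_def P_def by blast
        qed
        moreover have "v \<notin> RA"
        proof (cases "v = q")
          case True
          then show ?thesis using that False xy unfolding Q_def by auto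
        next
          case False
          then show ?thesis using G(3)[OF that(2,4)] disjR unfolding Q_def by blast
        qed
        ultimately show ?thesis by simp
      qed
      \<comment> \<open>\<open>m\<close> matches \<open>P\<close> with \<open>Q\<close>: for an
        index in \<open>X\<close> the two sets share that vertex, and the sets of \<open>x\<close>
        and \<open>y\<close> are joined by the deleted edge.\<close>
      define m where "m p = (if p = x then y else p)" for p
      have mQ: "m p \<in> Q" if "p \<in> P" for p using that unfolding m_def P_def Q_def by auto
      have m_inj: "m p \<noteq> m p'" if "p \<in> P" "p' \<in> P" "p \<noteq> p'" for p p'
        using that yX unfolding m_def P_def by auto
      have mX: "p = p'" if "p \<in> P" "p' \<in> P" "m p = p'" "p' \<in> X" for p p'
        using that yX xX unfolding m_def P_def by auto
      show ?thesis
      proof (rule linkedI[OF fP cP, of "\<lambda>p. F p \<union> G (m p)"])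
        have "(F p \<union> G (m p)) \<inter> (F p' \<union> G (m p')) = {}" if pp: "p \<in> P" "p' \<in> P" "p \<noteq> p'" for p p'
        proof -
          have "F p \<inter> F p' = {}" using F(1) pp unfolding disjoint_family_on_def by auto
          moreover have "G (m p) \<inter> G (m p') = {}"
            using G(1) mQ m_inj pp unfolding disjoint_family_on_def by auto
          moreover have "F p \<inter> G (m p') = {}" using FG[OF pp(1) mQ[OF pp(2)]] mX pp by blast
          moreover have "F p' \<inter> G (m p) = {}" using FG[OF pp(2) mQ[OF pp(1)]] mX pp by blast
          ultimately show ?thesis by blast
        qed
        then show "disjoint_family_on (\<lambda>p. F p \<union> G (m p)) P"
          unfolding disjoint_family_on_def by blast
      next
        fix p assume p: "p \<in> P"
        have cF: "conn_set E (F p)" "p \<in> F p" and cG: "conn_set E (G (m p))" "m p \<in> G (m p)"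
          using F(2)[OF p] G(2)[OF mQ[OF p]] E'E conn_set_mono by blast+
        have "conn_set E (F p \<union> G (m p))"
        proof (cases "p = x")
          case True
          then show ?thesis
            using xy cF cG less.prems(2) by (intro conn_set_join[where x=x and y=y]) (auto simp: m_def)
        next
          case False
          then show ?thesis using cF cG by (intro conn_set_Un[where z=p]) (auto simp: m_def)
        qed
        then show "conn_set E (F p \<union> G (m p)) \<and> (F p \<union> G (m p)) \<inter> A \<noteq> {} \<and> (F p \<union> G (m p)) \<inter> B \<noteq> {}"
          using F(2)[OF p] G(2)[OF mQ[OF p]] by blast
      qed
    qed
  qed
qed

section \<open>Walks and cycles\<close>

definition vwalk_in :: "('a \<times> 'a) set \<Rightarrow> 'a list \<Rightarrow> bool" where
  "vwalk_in E p \<longleftrightarrow> successively (\<lambda>u v. (u, v) \<in> E) p"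

lemma vwalk_in_Nil [simp]: "vwalk_in E []"
  by (simp add: vwalk_in_def)

lemma vwalk_in_Cons: "vwalk_in E (x # p) \<longleftrightarrow> p = [] \<or> (x, hd p) \<in> E \<and> vwalk_in E p"
  by (simp add: vwalk_in_def successively_Cons)

lemma vwalk_in_append:
  "vwalk_in E (p @ q) \<longleftrightarrow> vwalk_in E p \<and> vwalk_in E q \<and> (p = [] \<or> q = [] \<or> (last p, hd q) \<in> E)"
  by (simp add: vwalk_in_def successively_append_iff)

lemma vwalk_in_rev [simp]: "sym E \<Longrightarrow> vwalk_in E (rev p) \<longleftrightarrow> vwalk_in E p"
  by (simp add: vwalk_in_def sym_conv_converse_eq) (metis (mono_tags, lifting) converse_iff successively_mono)

lemma vwalk_in_mono: "vwalk_in E p \<Longrightarrow> E \<subseteq> E' \<Longrightarrow> vwalk_in E' p"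
  unfolding vwalk_in_def by (erule successively_mono) auto

lemma conn_set_vwalk_in:
  assumes "conn_set E W" "a \<in> W" "b \<in> W"
  shows "\<exists>p. p \<noteq> [] \<and> hd p = a \<and> last p = b \<and> vwalk_in E p \<and> set p \<subseteq> W"
proof -
  let ?D = "{v. \<exists>p. p \<noteq> [] \<and> hd p = a \<and> last p = v \<and> vwalk_in E p \<and> set p \<subseteq> W}"
  have "W \<subseteq> ?D"
  proof (rule conn_setD[OF assms(1) _ assms(2)])
    show "a \<in> ?D" using assms(2) by (auto intro!: exI[of _ "[a]"] simp: vwalk_in_Cons)
  next
    fix u v assume "u \<in> ?D" and uv: "v \<in> W" "(u, v) \<in> E"
    then obtain p where "p \<noteq> []" "hd p = a" "last p = u" "vwalk_in E p" "set p \<subseteq> W" by auto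
    then show "v \<in> ?D" using uv by (auto intro!: exI[of _ "p @ [v]"] simp: vwalk_in_append vwalk_in_Cons)
  qed
  then show ?thesis using assms(3) by blast
qed

text \<open>Take a shortest walk in \<open>W\<close> from \<open>A\<close> to \<open>B\<close>: a
  repeated vertex, a later visit to \<open>A\<close> or an earlier visit to \<open>B\<close> would
  each allow a shortcut.\<close>

lemma conn_set_shortest_path:
  assumes "conn_set E W" "W \<inter> A \<noteq> {}" "W \<inter> B \<noteq> {}"
  obtains p where "p \<noteq> []" "distinct p" "vwalk_in E p" "set p \<subseteq> W" "hd p \<in> A" "last p \<in> B"
    "set (tl p) \<inter> A = {}" "set (butlast p) \<inter> B = {}"
proof -
  define Q where "Q p \<longleftrightarrow> p \<noteq> [] \<and> vwalk_in E p \<and> set p \<subseteq> W \<and> hd p \<in> A \<and> last p \<in> B" for p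
  have "\<exists>p. Q p" using conn_set_vwalk_in[OF assms(1)] assms(2,3) unfolding Q_def by blast
  then obtain p where p: "Q p" and min: "\<And>q. Q q \<Longrightarrow> length p \<le> length q"
    using arg_min_nat_lemma[of Q _ length] by blast
  show thesis
  proof (rule that)
    show "distinct p"
    proof (rule ccontr)
      assume "\<not> distinct p"
      then obtain xs y ys zs where eq: "p = xs @ [y] @ ys @ [y] @ zs" using not_distinct_decomp by blast
      have "Q (xs @ [y] @ zs)"
        using p unfolding eq Q_def by (cases xs) (auto simp: vwalk_in_append vwalk_in_Cons hd_append)
      from min[OF this] show False unfolding eq by simp
    qed
    show "set (tl p) \<inter> A = {}"
    proof (rule ccontr)
      assume "set (tl p) \<inter> A \<noteq> {}"
      then obtain y us vs where y: "y \<in> A" "tl p = us @ y # vs" by (meson disjoint_iff split_list)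
      then have eq: "p = hd p # us @ y # vs" using p unfolding Q_def by (cases p) auto
      have "Q (y # vs)" using p y(1) unfolding Q_def
        by (subst (asm) (1 2 3 5) eq) (auto simp: vwalk_in_append vwalk_in_Cons split: if_splits)
      from min[OF this] show False by (subst (asm) eq) simp
    qed
    show "set (butlast p) \<inter> B = {}"
    proof (rule ccontr)
      assume "set (butlast p) \<inter> B \<noteq> {}"
      then obtain y us vs where y: "y \<in> B" "butlast p = us @ y # vs" by (meson disjoint_iff split_list)
      then have eq: "p = us @ y # vs @ [last p]"
        using p append_butlast_last_id[of p] unfolding Q_def by auto
      have "hd (us @ [y]) = hd p" by (subst eq) (cases us; simp)
      then have "Q (us @ [y])" using p y(1) unfolding Q_def
        by (subst (asm) (2 3) eq) (auto simp: vwalk_in_append vwalk_in_Cons)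
      from min[OF this] show False by (subst (asm) eq) simp
    qed
  qed (use p in \<open>auto simp: Q_def\<close>)
qed

section \<open>Cycles as vertex lists\<close>

definition vcycle :: "('a \<times> 'a) set \<Rightarrow> 'a list \<Rightarrow> bool" where
  "vcycle E xs \<longleftrightarrow> 3 \<le> length xs \<and> distinct xs \<and> vwalk_in E xs \<and> (last xs, hd xs) \<in> E"

lemma vcycle_rotate: "vcycle E (xs @ ys) \<Longrightarrow> vcycle E (ys @ xs)"
  by (cases "xs = [] \<or> ys = []") (auto simp: vcycle_def vwalk_in_append)

lemma vcycle_rev: "sym E \<Longrightarrow> vcycle E xs \<Longrightarrow> vcycle E (rev xs)"
  by (auto simp: vcycle_def hd_rev last_rev dest: symD)

lemma vcycle_mono: "vcycle E xs \<Longrightarrow> E \<subseteq> E' \<Longrightarrow> vcycle E' xs"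
  by (auto simp: vcycle_def intro: vwalk_in_mono)

lemma vcycle_rotate_to:
  assumes "vcycle E xs" "x \<in> set xs"
  obtains ys where "vcycle E (x # ys)" "set (x # ys) = set xs" "length (x # ys) = length xs"
proof -
  obtain us vs where eq: "xs = us @ x # vs" using assms(2) by (meson split_list)
  show thesis
    by (rule that[of "vs @ us"]) (use assms(1) vcycle_rotate[of E us "x # vs"] in \<open>auto simp: eq\<close>)
qed

lemma vcycle_set_subset:
  assumes "vcycle E xs" "E \<subseteq> V \<times> V"
  shows "set xs \<subseteq> V"
proof
  fix x assume "x \<in> set xs"
  then obtain ys where ys: "vcycle E (x # ys)" using vcycle_rotate_to[OF assms(1)] by metis
  then have "(x, hd ys) \<in> E" by (cases ys) (auto simp: vcycle_def vwalk_in_Cons)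
  then show "x \<in> V" using assms(2) by auto
qed

section \<open>Rerouting a cycle through a disjoint one\<close>

text \<open>\<open>\<alpha>\<close> and \<open>\<beta>\<close> stand for arcs of two disjoint
  cycles, \<open>i\<close> and \<open>j\<close> for the interiors of paths joining their first and
  their last vertices; hence \<open>\<beta>\<close> and \<open>i\<close> are run backwards.\<close>

lemma vcycle_two_paths:
  assumes "sym E" "\<alpha> \<noteq> []" "\<beta> \<noteq> []" "vwalk_in E \<alpha>" "vwalk_in E \<beta>"
    and "vwalk_in E (hd \<alpha> # i @ [hd \<beta>])" "vwalk_in E (last \<alpha> # j @ [last \<beta>])"
    and "distinct (\<alpha> @ j @ rev \<beta> @ rev i)" "3 \<le> length \<alpha> + length \<beta>"
  shows "vcycle E (\<alpha> @ j @ rev \<beta> @ rev i)"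
proof -
  have "vwalk_in E (\<alpha> @ j @ rev \<beta>)"
    using assms by (cases "j = []") (auto simp: vwalk_in_append vwalk_in_Cons hd_rev last_rev hd_append)
  moreover have "vwalk_in E (rev (hd \<alpha> # i @ [hd \<beta>]))" using assms by (simp only: vwalk_in_rev)
  then have "vwalk_in E (hd \<beta> # rev i @ [hd \<alpha>])" by simp
  ultimately show ?thesis
    using assms unfolding vcycle_def
    by (cases "i = []"; cases "j = []")
      (auto simp: vwalk_in_append vwalk_in_Cons hd_rev last_rev hd_append last_append)
qed

text \<open>The rerouted cycle trades \<open>p\<close> for \<open>\<beta>\<close> and the path
  interiors, so maximality gives \<open>length \<beta> <= length p\<close>. Adding
  \<open>length q\<close> completes the left side to the whole second cycle; three such bounds sum
  to \<open>3 |C'| <= |C| + |C'| - 6\<close>.\<close>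

lemma two_paths_bound:
  assumes "sym E" and C: "vcycle E (\<alpha> @ p)" and C': "vcycle E (\<beta> @ q)"
    and max: "\<And>xs. vcycle E xs \<Longrightarrow> length xs \<le> length (\<alpha> @ p)"
    and "vwalk_in E (hd \<alpha> # i @ [hd \<beta>])" "vwalk_in E (last \<alpha> # j @ [last \<beta>])"
    and "distinct (\<alpha> @ j @ \<beta> @ i)" "2 \<le> length \<alpha>" "\<beta> \<noteq> []"
  shows "length (\<beta> @ q) \<le> length p + length q"
proof -
  have "1 \<le> length \<beta>" using assms(9) by (cases \<beta>) auto
  then have "3 \<le> length \<alpha> + length \<beta>" using assms(8) by linarith
  moreover have "distinct (\<alpha> @ j @ rev \<beta> @ rev i)" using assms(7) by auto
  moreover have "vwalk_in E \<alpha>" "vwalk_in E \<beta>" "\<alpha> \<noteq> []"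
    using C C' assms(8) by (auto simp: vcycle_def vwalk_in_append)
  ultimately have "vcycle E (\<alpha> @ j @ rev \<beta> @ rev i)"
    using assms(1,5,6,9) by (intro vcycle_two_paths)
  from max[OF this] show ?thesis by simp
qed

text \<open>Each pair of the three paths closes up with the arcs containing the third path's ends. The
  three resulting cycles are no longer than \<open>C\<close>; adding these inequalities gives the bound.\<close>

lemma three_paths_bound_ordered:
  assumes "sym E"
    and C: "vcycle E (x1 # p1 @ x2 # p2 @ x3 # p3)" and C': "vcycle E (y1 # q1 @ y2 # q2 @ y3 # q3)"
    and max: "\<And>xs. vcycle E xs \<Longrightarrow> length xs \<le> length (x1 # p1 @ x2 # p2 @ x3 # p3)"
    and paths: "vwalk_in E (x1 # i1 @ [y1])" "vwalk_in E (x2 # i2 @ [y2])" "vwalk_in E (x3 # i3 @ [y3])"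
    and dist: "distinct ((x1 # p1 @ x2 # p2 @ x3 # p3) @ (y1 # q1 @ y2 # q2 @ y3 # q3) @ i1 @ i2 @ i3)"
  shows "2 * length (y1 # q1 @ y2 # q2 @ y3 # q3) \<le> length (x1 # p1 @ x2 # p2 @ x3 # p3)"
proof -
  \<comment> \<open>\<open>\<delta>\<close> collects the vertices that a rerouted cycle leaves out,
    so that its distinctness becomes an identity of multisets.\<close>
  have perm: "distinct \<gamma>"
    if "mset (\<gamma> @ \<delta>) = mset ((x1 # p1 @ x2 # p2 @ x3 # p3) @ (y1 # q1 @ y2 # q2 @ y3 # q3) @ i1 @ i2 @ i3)"
    for \<gamma> \<delta>
  proof -
    have "distinct (\<gamma> @ \<delta>)" using mset_eq_imp_distinct_iff[OF that] dist by blast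
    then show ?thesis by simp
  qed
  have "length ((y1 # q1 @ y2 # q2 @ [y3]) @ q3) \<le> length p3 + length q3"
  proof (rule two_paths_bound[OF assms(1)])
    show "distinct ((x1 # p1 @ x2 # p2 @ [x3]) @ i3 @ (y1 # q1 @ y2 # q2 @ [y3]) @ i1)"
      by (rule perm[of _ "p3 @ q3 @ i2"]) simp
  qed (use C C' max paths in auto)
  moreover have "length ((y2 # q2 @ y3 # q3 @ [y1]) @ q1) \<le> length p1 + length q1"
  proof (rule two_paths_bound[OF assms(1)])
    show "distinct ((x2 # p2 @ x3 # p3 @ [x1]) @ i1 @ (y2 # q2 @ y3 # q3 @ [y1]) @ i2)"
      by (rule perm[of _ "p1 @ q1 @ i3"]) simp
    show "vcycle E ((x2 # p2 @ x3 # p3 @ [x1]) @ p1)"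
      using vcycle_rotate[of E "x1 # p1" "x2 # p2 @ x3 # p3"] C by simp
    show "vcycle E ((y2 # q2 @ y3 # q3 @ [y1]) @ q1)"
      using vcycle_rotate[of E "y1 # q1" "y2 # q2 @ y3 # q3"] C' by simp
    show "length xs \<le> length ((x2 # p2 @ x3 # p3 @ [x1]) @ p1)" if "vcycle E xs" for xs
      using max[OF that] by simp
  qed (use paths in auto)
  moreover have "length ((y3 # q3 @ y1 # q1 @ [y2]) @ q2) \<le> length p2 + length q2"
  proof (rule two_paths_bound[OF assms(1)])
    show "distinct ((x3 # p3 @ x1 # p1 @ [x2]) @ i2 @ (y3 # q3 @ y1 # q1 @ [y2]) @ i3)"
      by (rule perm[of _ "p2 @ q2 @ i1"]) simp
    show "vcycle E ((x3 # p3 @ x1 # p1 @ [x2]) @ p2)"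
      using vcycle_rotate[of E "x1 # p1 @ x2 # p2" "x3 # p3"] C by simp
    show "vcycle E ((y3 # q3 @ y1 # q1 @ [y2]) @ q2)"
      using vcycle_rotate[of E "y1 # q1 @ y2 # q2" "y3 # q3"] C' by simp
    show "length xs \<le> length ((x3 # p3 @ x1 # p1 @ [x2]) @ p2)" if "vcycle E xs" for xs
      using max[OF that] by simp
  qed (use paths in auto)
  ultimately show ?thesis by simp
qed

lemma split_list_two:
  assumes "x \<in> set r" "y \<in> set r" "x \<noteq> y"
  obtains a b c where "r = a @ x # b @ y # c" | a b c where "r = a @ y # b @ x # c"
proof -
  obtain a d where r: "r = a @ x # d" using assms(1) by (meson split_list)
  then consider "y \<in> set a" | "y \<in> set d" using assms by auto
  then show thesis
  proof cases
    case 1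
    then obtain a1 a2 where "a = a1 @ y # a2" by (meson split_list)
    then show thesis using that(2) r by simp
  next
    case 2
    then obtain a1 a2 where "d = a1 @ y # a2" by (meson split_list)
    then show thesis using that(1) r by simp
  qed
qed

text \<open>Three vertices of a cycle have only two cyclic orders, mirror images of each other:
  reversing \<open>C'\<close> turns the wrong one into the right one.\<close>

lemma three_paths_bound_half_ordered:
  assumes "sym E"
    and C: "vcycle E (x1 # p1 @ x2 # p2 @ x3 # p3)" and C': "vcycle E C'"
    and max: "\<And>xs. vcycle E xs \<Longrightarrow> length xs \<le> length (x1 # p1 @ x2 # p2 @ x3 # p3)"
    and paths: "vwalk_in E (x1 # i1 @ [y1])" "vwalk_in E (x2 # i2 @ [y2])" "vwalk_in E (x3 # i3 @ [y3])"
    and y: "{y1, y2, y3} \<subseteq> set C'" "distinct [y1, y2, y3]"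
    and dist: "distinct ((x1 # p1 @ x2 # p2 @ x3 # p3) @ C' @ i1 @ i2 @ i3)"
  shows "2 * length C' \<le> length (x1 # p1 @ x2 # p2 @ x3 # p3)"
proof -
  obtain s where s: "vcycle E (y1 # s)" "set (y1 # s) = set C'" "length (y1 # s) = length C'"
    using vcycle_rotate_to[OF C', of y1] y by auto
  have "distinct (y1 # s)" using s(1) by (simp add: vcycle_def)
  then have dist': "distinct ((x1 # p1 @ x2 # p2 @ x3 # p3) @ (y1 # s) @ i1 @ i2 @ i3)"
    using dist unfolding distinct_append set_append s(2) by blast
  have "y2 \<in> set s" "y3 \<in> set s" "y2 \<noteq> y3" using y s(2) by auto
  then show ?thesis
  proof (cases rule: split_list_two)
    case (1 a b c)
    show ?thesis
      using three_paths_bound_ordered[OF assms(1) C s(1)[unfolded 1] max paths dist'[unfolded 1]]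
        s(3)[unfolded 1] by simp
  next
    case (2 a b c)
    have "vcycle E (rev ((y1 # a @ y3 # b @ y2 # c)))"
      using s(1) assms(1) unfolding 2 by (intro vcycle_rev)
    then have "vcycle E ((rev c @ y2 # rev b @ y3 # rev a) @ [y1])" by simp
    from vcycle_rotate[OF this]
    have c: "vcycle E (y1 # rev c @ y2 # rev b @ y3 # rev a)" by simp
    have "distinct ((x1 # p1 @ x2 # p2 @ x3 # p3) @ (y1 # rev c @ y2 # rev b @ y3 # rev a) @ i1 @ i2 @ i3)"
      by (rule iffD1[OF mset_eq_imp_distinct_iff dist'[unfolded 2]]) simp
    from three_paths_bound_ordered[OF assms(1) C c max paths this] show ?thesis
      using s(3)[unfolded 2] by simp
  qed
qed

text \<open>A wrong order on \<open>C\<close> is repaired by exchanging the names of the second and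
  third path, since the order on \<open>C'\<close> is free by now.\<close>

lemma three_paths_bound:
  assumes "sym E" and C: "vcycle E C" and C': "vcycle E C'"
    and max: "\<And>xs. vcycle E xs \<Longrightarrow> length xs \<le> length C"
    and paths: "vwalk_in E (x1 # i1 @ [y1])" "vwalk_in E (x2 # i2 @ [y2])" "vwalk_in E (x3 # i3 @ [y3])"
    and x: "{x1, x2, x3} \<subseteq> set C" "distinct [x1, x2, x3]"
    and y: "{y1, y2, y3} \<subseteq> set C'" "distinct [y1, y2, y3]"
    and dist: "distinct (C @ C' @ i1 @ i2 @ i3)"
  shows "2 * length C' \<le> length C"
proof -
  obtain s where s: "vcycle E (x1 # s)" "set (x1 # s) = set C" "length (x1 # s) = length C"
    using vcycle_rotate_to[OF C, of x1] x by auto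
  have "distinct (x1 # s)" using s(1) by (simp add: vcycle_def)
  then have dist': "distinct ((x1 # s) @ C' @ i1 @ i2 @ i3)"
    using dist unfolding distinct_append set_append s(2) by blast
  have max': "length xs \<le> length (x1 # s)" if "vcycle E xs" for xs using max[OF that] s(3) by simp
  have "x2 \<in> set s" "x3 \<in> set s" "x2 \<noteq> x3" using x s(2) by auto
  then show ?thesis
  proof (cases rule: split_list_two)
    case (1 a b c)
    show ?thesis
      using three_paths_bound_half_ordered[OF assms(1) s(1)[unfolded 1] C' max'[unfolded 1] paths y
          dist'[unfolded 1]] s(3)[unfolded 1] by simp
  next
    case (2 a b c)
    have "distinct ((x1 # a @ x3 # b @ x2 # c) @ C' @ i1 @ i3 @ i2)"
      by (rule iffD1[OF mset_eq_imp_distinct_iff dist'[unfolded 2]]) simp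
    from three_paths_bound_half_ordered[OF assms(1) s(1)[unfolded 2] C' max'[unfolded 2] paths(1,3,2)
          _ _ this] show ?thesis using y s(3)[unfolded 2] by auto
  qed
qed

text \<open>A cycle passes through the virtual edge at most once. Replacing it by the path, whose
  interior \<open>q\<close> lies outside \<open>A\<close>, gives a cycle of \<open>E\<close> that is
  at least as long.\<close>

lemma vcycle_virtual_edge_bound:
  assumes "sym E" and bound: "\<And>xs. vcycle E xs \<Longrightarrow> length xs \<le> k"
    and path: "vwalk_in E (x # q @ [y])" "distinct (x # q @ [y])" "set q \<inter> A = {}" "x \<in> A" "y \<in> A"
    and xs: "vcycle (E \<inter> A \<times> A \<union> {(x, y), (y, x)}) xs"
  shows "length xs \<le> k"
proof (cases "vcycle E xs")
  case True
  then show ?thesis by (rule bound)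
next
  case False
  let ?E = "E \<inter> A \<times> A \<union> {(x, y), (y, x)}"
  \<comment> \<open>Some cyclically consecutive pair is not in \<open>E\<close>; a rotation makes it
    the closing pair.\<close>
  obtain ys where ys: "vcycle ?E ys" "length ys = length xs" "(last ys, hd ys) \<notin> E"
  proof (cases "(last xs, hd xs) \<in> E")
    case True
    then obtain i where i: "Suc i < length xs" "(xs ! i, xs ! Suc i) \<notin> E"
      using \<open>\<not> vcycle E xs\<close> xs unfolding vcycle_def vwalk_in_def successively_conv_nth by blast
    show thesis
    proof (rule that[of "drop (Suc i) xs @ take (Suc i) xs"])
      show "vcycle ?E (drop (Suc i) xs @ take (Suc i) xs)" by (rule vcycle_rotate) (use xs in simp)
      have "last (drop (Suc i) xs @ take (Suc i) xs) = xs ! i"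
        using i by (simp add: last_append take_Suc_conv_app_nth)
      moreover have "hd (drop (Suc i) xs @ take (Suc i) xs) = xs ! Suc i"
        using i by (simp add: hd_append hd_drop_conv_nth)
      ultimately show "(last (drop (Suc i) xs @ take (Suc i) xs), hd (drop (Suc i) xs @ take (Suc i) xs)) \<notin> E"
        using i by simp
    qed simp
  next
    case False
    then show thesis using that[of xs] xs by simp
  qed
  have ne: "ys \<noteq> []" and len: "3 \<le> length ys" and dys: "distinct ys" using ys(1) by (auto simp: vcycle_def)
  have ends: "(last ys, hd ys) = (x, y) \<or> (last ys, hd ys) = (y, x)"
    using ys(1,3) unfolding vcycle_def by auto
  have "vwalk_in E ys" unfolding vwalk_in_def successively_conv_nth
  proof (intro allI impI)
    fix i assume i: "Suc i < length ys"
    have "(ys ! i, ys ! Suc i) \<in> ?E"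
      using ys(1) i unfolding vcycle_def vwalk_in_def successively_conv_nth by auto
    \<comment> \<open>A second use of the virtual edge would have the same two ends. By distinctness
      they sit at the first and last positions, which are neighbours only in a list of length
      two.\<close>
    moreover have False if "(ys ! i, ys ! Suc i) \<in> {(x, y), (y, x)}"
    proof -
      have "{ys ! i, ys ! Suc i} = {ys ! 0, ys ! (length ys - 1)}"
        using that ends ne by (auto simp: hd_conv_nth last_conv_nth)
      moreover have "a = b" if "ys ! a = ys ! b" "a < length ys" "b < length ys" for a b
        using that nth_eq_iff_index_eq[OF dys] by blast
      moreover have "i < length ys" "0 < length ys" "length ys - 1 < length ys" using i by auto
      ultimately have "(i = 0 \<and> Suc i = length ys - 1) \<or> (i = length ys - 1 \<and> Suc i = 0)"
        using i unfolding doubleton_eq_iff by blast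
      then show False using len by auto
    qed
    ultimately show "(ys ! i, ys ! Suc i) \<in> E" by auto
  qed
  have ysA: "set ys \<subseteq> A" by (rule vcycle_set_subset[OF ys(1)]) (use path in auto)
  obtain q' where q': "vwalk_in E (last ys # q' @ [hd ys])" "set q' = set q" "distinct q'"
  proof (cases "last ys = x \<and> hd ys = y")
    case True
    then show thesis using that[of q] path by auto
  next
    case False
    then have *: "last ys = y" "hd ys = x" using ends by auto
    have "vwalk_in E (rev (x # q @ [y]))" using path assms(1) by (simp only: vwalk_in_rev)
    then show thesis using that[of "rev q"] * path by auto
  qed
  have "vcycle E (ys @ q')"
    unfolding vcycle_def using ne len dys \<open>vwalk_in E ys\<close> q' ysA path(3)
    by (cases "q' = []") (auto simp: vwalk_in_append vwalk_in_Cons hd_append last_append)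
  from bound[OF this] show ?thesis using ys(2) by simp
qed

text \<open>All neighbours of the first vertex \<open>x\<close> of a longest path lie on the path;
  closing up at the last of them gives a cycle through \<open>x\<close> and at least three
  neighbours. The length four later forces \<open>4 <= k\<close>.\<close>

lemma vcycle_min_degree_3:
  assumes "finite V" "E \<subseteq> V \<times> V" "sym E" "irrefl E" "V \<noteq> {}"
    and deg: "\<And>v. v \<in> V \<Longrightarrow> 3 \<le> card {u. (v, u) \<in> E}"
  obtains xs where "vcycle E xs" "4 \<le> length xs"
proof -
  define Q where "Q p \<longleftrightarrow> p \<noteq> [] \<and> distinct p \<and> vwalk_in E p \<and> set p \<subseteq> V" for p
  obtain v where "v \<in> V" using assms(5) by auto
  then have "Q [v]" by (simp add: Q_def vwalk_in_Cons)
  moreover have "\<forall>p. Q p \<longrightarrow> length p < Suc (card V)"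
    unfolding Q_def using assms(1) by (metis card_mono distinct_card le_imp_less_Suc)
  ultimately obtain p where p: "Q p" and max: "\<And>q. Q q \<Longrightarrow> length q \<le> length p"
    using Lattices_Big.ex_has_greatest_nat[of Q "[v]" length] by blast
  then obtain x q where eq: "p = x # q" unfolding Q_def by (cases p) auto
  let ?N = "{u. (x, u) \<in> E}"
  have finN: "finite ?N" by (rule finite_subset[of _ V]) (use assms in auto)
  have N: "?N \<subseteq> set q"
  proof
    fix u assume u: "u \<in> ?N"
    show "u \<in> set q"
    proof (rule ccontr)
      assume "u \<notin> set q"
      then have "Q (u # p)"
        using u p assms(2-4) unfolding eq Q_def by (auto simp: vwalk_in_Cons irrefl_def dest: symD)
      from max[OF this] show False by simp
    qed
  qed
  have "x \<in> V" using p unfolding eq Q_def by auto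
  from deg[OF this] have c3: "3 \<le> card ?N" .
  then have "?N \<noteq> {}" by (metis card.empty not_numeral_le_zero)
  then have "\<exists>z \<in> set q. (x, z) \<in> E" using N by auto
  then obtain q1 z q2 where q: "q = q1 @ z # q2" "(x, z) \<in> E" "\<forall>u \<in> set q2. (x, u) \<notin> E"
    using split_list_last_propE[of q "\<lambda>z. (x, z) \<in> E"] by metis
  have "?N \<subseteq> set (q1 @ [z])" using N q by auto
  then have "card ?N \<le> length (q1 @ [z])"
    by (meson List.finite_set card_length card_mono le_trans)
  then have "3 \<le> length (q1 @ [z])" using c3 by linarith
  moreover have "vcycle E (x # q1 @ [z])"
    using p q(2) assms(3) calculation unfolding eq q(1) Q_def vcycle_def
    by (auto simp: vwalk_in_append vwalk_in_Cons hd_append dest: symD split: if_splits)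
  ultimately show thesis using that by auto
qed

section \<open>Clustered colourings\<close>

text \<open>The order is \<open>card (A \<inter> B)\<close>. Nonempty differences make both sides
  proper subsets of \<open>V\<close>, as induction on \<open>card V\<close> requires.\<close>

definition separation :: "'a set \<Rightarrow> ('a \<times> 'a) set \<Rightarrow> 'a set \<Rightarrow> 'a set \<Rightarrow> bool" where
  "separation V E A B \<longleftrightarrow> A \<union> B = V \<and> A - B \<noteq> {} \<and> B - A \<noteq> {} \<and> E \<inter> (A - B) \<times> (B - A) = {}"

lemma separation_commute: "sym E \<Longrightarrow> separation V E A B \<Longrightarrow> separation V E B A"
  unfolding separation_def sym_def by blast

text \<open>Members of \<open>P\<close> missing from \<open>A\<close> and from \<open>B\<close>
  would be adjacent across the separation. This is why only cliques are precoloured: some side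
  contains \<open>P\<close> and can be coloured first.\<close>

lemma separation_clique:
  assumes "separation V E A B" "P \<subseteq> V" "\<And>p q. \<lbrakk>p \<in> P; q \<in> P; p \<noteq> q\<rbrakk> \<Longrightarrow> (p, q) \<in> E"
  shows "P \<subseteq> A \<or> P \<subseteq> B"
proof (rule ccontr)
  assume "\<not> (P \<subseteq> A \<or> P \<subseteq> B)"
  then obtain p q where "p \<in> P" "p \<notin> A" "q \<in> P" "q \<notin> B" by auto
  then show False using assms(1,2) assms(3)[of q p] unfolding separation_def by blast
qed

text \<open>The induction hypothesis: a precolouring \<open>g\<close> of a clique \<open>P\<close> of at most two vertices extends so
  that no monochromatic edge leaves \<open>P\<close>. This is what keeps monochromatic components from growing
  when two sides of a separation are glued along \<open>P\<close>.\<close>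

definition clustered_extension ::
    "nat \<Rightarrow> 'c set \<Rightarrow> ('a \<times> 'a) set \<Rightarrow> 'a set \<Rightarrow> 'a set \<Rightarrow> ('a \<Rightarrow> 'c) \<Rightarrow> ('a \<Rightarrow> 'c) \<Rightarrow> bool" where
  "clustered_extension k S E V P g f \<longleftrightarrow> f ` V \<subseteq> S \<and> (\<forall>p \<in> P. f p = g p) \<and>
    (\<forall>p \<in> P. \<forall>u \<in> V - P. (p, u) \<in> E \<longrightarrow> f u \<noteq> f p) \<and>
    (\<forall>W \<subseteq> V. conn_set E W \<longrightarrow> (\<forall>u \<in> W. \<forall>v \<in> W. f u = f v) \<longrightarrow> card W \<le> k)"

definition extendable :: "nat \<Rightarrow> 'c set \<Rightarrow> ('a \<times> 'a) set \<Rightarrow> 'a set \<Rightarrow> 'a set \<Rightarrow> bool" where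
  "extendable k S E V P \<longleftrightarrow> (\<forall>g. g ` P \<subseteq> S \<longrightarrow> (\<exists>f. clustered_extension k S E V P g f))"

lemma clustered_extensionI:
  assumes "f ` V \<subseteq> S" "\<And>p. p \<in> P \<Longrightarrow> f p = g p"
    "\<And>p u. \<lbrakk>p \<in> P; u \<in> V - P; (p, u) \<in> E\<rbrakk> \<Longrightarrow> f u \<noteq> f p"
    "\<And>W. \<lbrakk>W \<subseteq> V; conn_set E W; \<And>u v. \<lbrakk>u \<in> W; v \<in> W\<rbrakk> \<Longrightarrow> f u = f v\<rbrakk> \<Longrightarrow> card W \<le> k"
  shows "clustered_extension k S E V P g f"
  unfolding clustered_extension_def
proof (intro conjI ballI allI impI)
  fix W assume "W \<subseteq> V" "conn_set E W" "\<forall>u \<in> W. \<forall>v \<in> W. f u = f v"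
  then show "card W \<le> k" by (intro assms(4)) blast+
qed (use assms(1-3) in blast)+

lemma clustered_extensionD:
  assumes "clustered_extension k S E V P g f"
  shows "f ` V \<subseteq> S" "\<And>p. p \<in> P \<Longrightarrow> f p = g p"
    "\<And>p u. \<lbrakk>p \<in> P; u \<in> V - P; (p, u) \<in> E\<rbrakk> \<Longrightarrow> f u \<noteq> f p"
    "\<And>W. \<lbrakk>W \<subseteq> V; conn_set E W; \<And>u v. \<lbrakk>u \<in> W; v \<in> W\<rbrakk> \<Longrightarrow> f u = f v\<rbrakk> \<Longrightarrow> card W \<le> k"
  using assms unfolding clustered_extension_def by blast+

section \<open>Gluing colourings and tiny graphs\<close>

text \<open>An edge from \<open>A\<close> into \<open>B - A\<close> starts in the separator, from
  which \<open>B\<close> is coloured by extension, so it is not monochromatic. Hence a connected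
  monochromatic set lies in \<open>A\<close> or in \<open>B - A\<close>. Further edges in
  \<open>EA\<close> and \<open>EB\<close> only make the colourings of the sides more restrictive,
  which leaves room for virtual edges.\<close>

lemma extendable_glue:
  assumes "sym E" "separation V E A B" "E \<inter> A \<times> A \<subseteq> EA" "E \<inter> B \<times> B \<subseteq> EB" "P \<subseteq> A"
    and A: "extendable k S EA A P" and B: "extendable k S EB B (A \<inter> B)"
  shows "extendable k S E V P"
  unfolding extendable_def
proof (intro allI impI)
  fix g :: "'a \<Rightarrow> 'b" assume "g ` P \<subseteq> S"
  then obtain fA where "clustered_extension k S EA A P g fA"
    using A unfolding extendable_def by blast
  note fA = clustered_extensionD[OF this]
  have "fA ` (A \<inter> B) \<subseteq> S" using fA(1) by auto
  then obtain fB where "clustered_extension k S EB B (A \<inter> B) fA fB"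
    using B unfolding extendable_def by blast
  note fB = clustered_extensionD[OF this]
  define f where "f v = (if v \<in> A then fA v else fB v)" for v
  have fB': "f v = fB v" if "v \<in> B" for v using that fB(2) unfolding f_def by auto
  have V: "V = A \<union> B" using assms(2) unfolding separation_def by auto
  have cross: "f u \<noteq> f p" if "p \<in> A" "u \<in> B - A" "(p, u) \<in> E" for p u
  proof -
    have "p \<in> B" using that assms(2) unfolding separation_def by blast
    then have "(p, u) \<in> EB" using that assms(4) by auto
    then show ?thesis using fB(3)[of p u] fB'[of p] fB'[of u] that \<open>p \<in> B\<close> by auto
  qed
  have cW: "card W \<le> k" if W: "W \<subseteq> V" "conn_set E W" "\<And>u v. \<lbrakk>u \<in> W; v \<in> W\<rbrakk> \<Longrightarrow> f u = f v" for W
  proof (cases "W \<subseteq> A")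
    case True
    have "conn_set EA W" using W(2) by (rule conn_set_mono) (use True assms(3) in auto)
    moreover have "fA u = fA v" if "u \<in> W" "v \<in> W" for u v
      using W(3)[OF that] subsetD[OF True that(1)] subsetD[OF True that(2)] unfolding f_def by simp
    ultimately show ?thesis by (rule fA(4)[OF True])
  next
    case False
    then obtain b where b: "b \<in> W" "b \<in> B - A" using W(1) V by auto
    have WB: "W \<subseteq> B - A"
    proof (rule ccontr)
      assume "\<not> W \<subseteq> B - A"
      then obtain a where "a \<in> W" "a \<notin> B - A" by auto
      then obtain u v where uv: "u \<in> W" "u \<in> B - A" "v \<in> W" "v \<notin> B - A" "(u, v) \<in> E"
        using conn_set_crossing[OF W(2) b] by blast
      then have "v \<in> A" "(v, u) \<in> E" using W(1) V assms(1) by (auto dest: symD)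
      then show False using cross[of v u] uv W(3)[of u v] by auto
    qed
    have "conn_set EB W" using W(2) by (rule conn_set_mono) (use WB assms(4) in auto)
    moreover have "fB u = fB v" if "u \<in> W" "v \<in> W" for u v
      using W(3)[OF that] subsetD[OF WB that(1)] subsetD[OF WB that(2)] unfolding f_def by simp
    moreover have "W \<subseteq> B" using WB by auto
    ultimately show ?thesis by (intro fB(4))
  qed
  have "f u \<noteq> f p" if "p \<in> P" "u \<in> V - P" "(p, u) \<in> E" for p u
  proof (cases "u \<in> A")
    case True
    then show ?thesis using that assms(3,5) fA(3)[of p u] unfolding f_def by auto
  next
    case False
    then show ?thesis using that assms(5) V by (intro cross) auto
  qed
  moreover have "f ` V \<subseteq> S" using fA(1) fB(1) V unfolding f_def by auto
  moreover have "f p = g p" if "p \<in> P" for p using that fA(2) assms(5) unfolding f_def by auto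
  ultimately show "\<exists>f. clustered_extension k S E V P g f"
  proof (intro exI[of _ f] clustered_extensionI)
    show "card W \<le> k" if "W \<subseteq> V" "conn_set E W" "\<And>u v. \<lbrakk>u \<in> W; v \<in> W\<rbrakk> \<Longrightarrow> f u = f v" for W
      by (rule cW[OF that])
  qed auto
qed

text \<open>There are enough colours to give the vertices outside \<open>P\<close> distinct colours
  that do not occur on \<open>P\<close>. A monochromatic set is then a single vertex or part of
  \<open>P\<close>.\<close>

lemma extendable_small:
  assumes "finite V" "card V \<le> 3" "P \<subseteq> V" "card P \<le> 2" "2 \<le> k" "finite S" "3 \<le> card S"
  shows "extendable k S E V P"
  unfolding extendable_def
proof (intro allI impI)
  fix g :: "'a \<Rightarrow> 'b" assume g: "g ` P \<subseteq> S"
  have finP: "finite P" using assms(1,3) finite_subset by auto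
  have "card (V - P) = card V - card P" using assms finP by (simp add: card_Diff_subset)
  moreover have "card (S - g ` P) = card S - card (g ` P)" using g finP by (simp add: card_Diff_subset)
  moreover have "card (g ` P) \<le> card P" using finP by (rule card_image_le)
  ultimately have "card (V - P) \<le> card (S - g ` P)" using assms by linarith
  then obtain h where h: "h ` (V - P) \<subseteq> S - g ` P" "inj_on h (V - P)"
    using card_le_inj[of "V - P" "S - g ` P"] assms by auto
  define f where "f v = (if v \<in> P then g v else h v)" for v
  have h': "h v \<in> S" "h v \<notin> g ` P" if "v \<in> V" "v \<notin> P" for v using h(1) that by auto
  have cW: "card W \<le> k" if W: "W \<subseteq> V" "\<And>u v. \<lbrakk>u \<in> W; v \<in> W\<rbrakk> \<Longrightarrow> f u = f v" for W
  proof (cases "W \<inter> P = {}")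
    case True
    then have "u = v" if "u \<in> W" "v \<in> W" for u v
      using that W(1) W(2)[OF that] inj_onD[OF h(2), of u v] unfolding f_def by (auto simp: disjoint_iff subset_iff)
    then have "card W \<le> Suc 0" using W assms(1) by (subst card_le_Suc0_iff_eq) (auto intro: finite_subset)
    then show ?thesis using assms(5) by linarith
  next
    case False
    then obtain p where p: "p \<in> W" "p \<in> P" by auto
    have "u \<in> P" if "u \<in> W" for u
    proof (rule ccontr)
      assume "u \<notin> P"
      then have "g p = h u" using W(2)[OF p(1) that] p unfolding f_def by simp
      then show False using h'(2)[of u] p that W(1) \<open>u \<notin> P\<close> by (metis image_eqI subsetD)
    qed
    then have "card W \<le> card P" using finP by (intro card_mono) auto
    then show ?thesis using assms by linarith
  qed
  have "f u \<noteq> f p" if "p \<in> P" "u \<in> V - P" for p u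
    using h'(2)[of u] that unfolding f_def by auto
  moreover have "f ` V \<subseteq> S" using g h' unfolding f_def by auto
  moreover have "f p = g p" if "p \<in> P" for p using that by (simp add: f_def)
  ultimately show "\<exists>f. clustered_extension k S E V P g f"
  proof (intro exI[of _ f] clustered_extensionI)
    show "card W \<le> k" if "W \<subseteq> V" "conn_set E W" "\<And>u v. \<lbrakk>u \<in> W; v \<in> W\<rbrakk> \<Longrightarrow> f u = f v" for W
      by (rule cW[OF that(1,3)])
  qed auto
qed

section \<open>Graphs without small separations\<close>

text \<open>\<open>D\<close> is what can be reached from \<open>C\<close> without touching
  \<open>X\<close>; the sides are \<open>D\<close> with \<open>X\<close>, and everything but
  \<open>D\<close>. As \<open>X\<close> is smaller than \<open>C\<close> and \<open>C'\<close>, each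
  has a vertex outside \<open>X\<close>, and these two make the sides proper.\<close>

lemma separates_imp_separation:
  assumes "finite V" "E \<subseteq> V \<times> V" "sym E" "C \<subseteq> V" "C' \<subseteq> V"
    and "finite X" "card X < card C" "card X < card C'" "separates E C C' X"
  obtains A B where "separation V E A B" "card (A \<inter> B) \<le> card X"
proof -
  have "\<not> C \<subseteq> X" "\<not> C' \<subseteq> X" using assms(6-8) card_mono by (meson leD)+
  then obtain c c' where c: "c \<in> C - X" "c' \<in> C' - X" by auto
  define D where "D = \<Union>{U. U \<subseteq> V - X \<and> conn_set E U \<and> U \<inter> C \<noteq> {}}"
  have DV: "D \<subseteq> V - X" unfolding D_def by auto
  have cD: "c \<in> D" unfolding D_def using c assms(4) by (auto intro!: exI[of _ "{c}"])
  have c'D: "c' \<notin> D"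
  proof
    assume "c' \<in> D"
    then obtain U where "U \<subseteq> V - X" "conn_set E U" "U \<inter> C \<noteq> {}" "c' \<in> U" unfolding D_def by auto
    then show False using assms(9) c unfolding separates_def by blast
  qed
  have closed: "v \<in> D" if "u \<in> D" "v \<in> V - X" "(u, v) \<in> E" for u v
  proof -
    obtain U where U: "U \<subseteq> V - X" "conn_set E U" "U \<inter> C \<noteq> {}" "u \<in> U"
      using \<open>u \<in> D\<close> unfolding D_def by auto
    have "conn_set E (U \<union> {v})"
      by (rule conn_set_join[OF assms(3) U(2) conn_set_singleton U(4) _ that(3)]) simp
    then have "U \<union> {v} \<subseteq> D" unfolding D_def using U that(2) by (intro Union_upper) auto
    then show ?thesis by simp
  qed
  show thesis
  proof (rule that[of "D \<union> (X \<inter> V)" "V - D"])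
    show "separation V E (D \<union> (X \<inter> V)) (V - D)"
      unfolding separation_def using DV cD c'D c assms(5) closed by blast
    have "(D \<union> (X \<inter> V)) \<inter> (V - D) \<subseteq> X" by auto
    then show "card ((D \<union> (X \<inter> V)) \<inter> (V - D)) \<le> card X" using assms(6) by (intro card_mono)
  qed
qed

lemma disjoint_cycle_half:
  assumes "finite V" "E \<subseteq> V \<times> V" "sym E"
    and nosep: "\<And>A B. separation V E A B \<Longrightarrow> 3 \<le> card (A \<inter> B)"
    and C: "vcycle E C" and max: "\<And>xs. vcycle E xs \<Longrightarrow> length xs \<le> length C"
    and C': "vcycle E C'" and disj: "set C \<inter> set C' = {}"
  shows "2 * length C' \<le> length C"
proof -
  have card: "3 \<le> card (set C)" "3 \<le> card (set C')"
    using C C' by (simp_all add: vcycle_def distinct_card)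
  have "linked E (set C) (set C') 3"
  proof (rule menger)
    show "finite E" using assms(1,2) by (meson finite_SigmaI finite_subset)
    fix X assume X: "finite X" "separates E (set C) (set C') X"
    \<comment> \<open>A cycle has at least three vertices, so a separator of order at most two
      covers neither cycle and would give a forbidden separation.\<close>
    show "3 \<le> card X"
    proof (rule ccontr)
      assume "\<not> 3 \<le> card X"
      then have "card X < card (set C)" "card X < card (set C')" using card by linarith+
      then obtain A B where "separation V E A B" "card (A \<inter> B) \<le> card X"
        using separates_imp_separation[OF assms(1-3) vcycle_set_subset[OF C assms(2)]
            vcycle_set_subset[OF C' assms(2)] X(1) _ _ X(2)] by blast
      then show False using nosep \<open>\<not> 3 \<le> card X\<close> by force
    qed
  qed (use assms in auto)
  then obtain F where F: "disjoint_family_on F {..<3::nat}"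
    "\<And>i. i < 3 \<Longrightarrow> conn_set E (F i) \<and> F i \<inter> set C \<noteq> {} \<and> F i \<inter> set C' \<noteq> {}"
    unfolding linked_def by blast
  \<comment> \<open>A shortest path inside each linking set meets the two cycles only in its ends
    \<open>x\<close> and \<open>y\<close>; these differ because the cycles are disjoint.\<close>
  have "\<exists>x q y. vwalk_in E (x # q @ [y]) \<and> distinct (x # q @ [y]) \<and> set (x # q @ [y]) \<subseteq> F i \<and>
      x \<in> set C \<and> y \<in> set C' \<and> set q \<inter> (set C \<union> set C') = {}" if i: "i < 3" for i
  proof -
    obtain p where p: "p \<noteq> []" "distinct p" "vwalk_in E p" "set p \<subseteq> F i" "hd p \<in> set C" "last p \<in> set C'"
      "set (tl p) \<inter> set C = {}" "set (butlast p) \<inter> set C' = {}"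
      using conn_set_shortest_path[of E "F i" "set C" "set C'"] F(2)[OF i] by metis
    obtain x r where pr: "p = x # r" using p(1) by (cases p) auto
    have "r \<noteq> []" using p(5,6) disj unfolding pr by auto
    then obtain q y where r: "r = q @ [y]" by (cases r rule: rev_cases) auto
    show ?thesis using p unfolding pr r by (intro exI[of _ x] exI[of _ q] exI[of _ y]) auto
  qed
  then obtain x q y where xqy: "\<And>i. i < 3 \<Longrightarrow> vwalk_in E (x i # q i @ [y i]) \<and>
      distinct (x i # q i @ [y i]) \<and> set (x i # q i @ [y i]) \<subseteq> F i \<and>
      x i \<in> set C \<and> y i \<in> set C' \<and> set (q i) \<inter> (set C \<union> set C') = {}" by metis
  have Fd: "F i \<inter> F j = {}" if "i < 3" "j < 3" "i \<noteq> j" for i j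
    using F(1) that unfolding disjoint_family_on_def by auto
  have F3: "F 0 \<inter> F 1 = {}" "F 0 \<inter> F 2 = {}" "F 1 \<inter> F 2 = {}" by (rule Fd; simp)+
  have p0: "vwalk_in E (x 0 # q 0 @ [y 0])" and p1: "vwalk_in E (x 1 # q 1 @ [y 1])"
    and p2: "vwalk_in E (x 2 # q 2 @ [y 2])"
    and d: "distinct (q 0)" "distinct (q 1)" "distinct (q 2)"
    and s: "x 0 \<in> F 0" "y 0 \<in> F 0" "set (q 0) \<subseteq> F 0" "x 1 \<in> F 1" "y 1 \<in> F 1" "set (q 1) \<subseteq> F 1"
      "x 2 \<in> F 2" "y 2 \<in> F 2" "set (q 2) \<subseteq> F 2"
    and xy: "{x 0, x 1, x 2} \<subseteq> set C" "{y 0, y 1, y 2} \<subseteq> set C'"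
    and int: "set (q 0) \<inter> (set C \<union> set C') = {}" "set (q 1) \<inter> (set C \<union> set C') = {}"
      "set (q 2) \<inter> (set C \<union> set C') = {}"
    using xqy[of 0] xqy[of 1] xqy[of 2] by auto
  show ?thesis
  proof (rule three_paths_bound[OF assms(3) C C' max p0 p1 p2 xy(1) _ xy(2)])
    show "distinct [x 0, x 1, x 2]" using s F3 by auto
    show "distinct [y 0, y 1, y 2]" using s F3 by auto
    have "distinct C" "distinct C'" using C C' by (auto simp: vcycle_def)
    moreover have "set (q 0) \<inter> set (q 1) = {}" "set (q 0) \<inter> set (q 2) = {}" "set (q 1) \<inter> set (q 2) = {}"
      using s F3 by blast+
    ultimately show "distinct (C @ C' @ q 0 @ q 1 @ q 2)"
      using d int disj unfolding distinct_append set_append by blast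
  qed
qed

text \<open>The neighbours of a vertex of degree at most two would cut it off from a fourth vertex,
  a separation of order at most two.\<close>

lemma degree_ge_3:
  assumes "finite V" "E \<subseteq> V \<times> V" "sym E" "irrefl E" "4 \<le> card V"
    and nosep: "\<And>A B. separation V E A B \<Longrightarrow> 3 \<le> card (A \<inter> B)"
    and v: "v \<in> V"
  shows "3 \<le> card {u. (v, u) \<in> E}"
proof (rule ccontr)
  let ?N = "{u. (v, u) \<in> E}"
  assume less: "\<not> 3 \<le> card ?N"
  have NV: "?N \<subseteq> V - {v}" using assms(2,4) by (auto simp: irrefl_def)
  then have fin: "finite ?N" using assms(1) by (meson finite_Diff finite_subset)
  have "card (insert v ?N) \<le> Suc (card ?N)" using fin by (simp add: card_insert_if)
  then have "card (insert v ?N) < card V" using less assms(5) by linarith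
  then have "\<not> V \<subseteq> insert v ?N" using fin card_mono by (meson finite_insert leD)
  then have "separation V E (insert v ?N) (V - {v})"
    using NV v unfolding separation_def by blast
  then have "3 \<le> card (insert v ?N \<inter> (V - {v}))" by (rule nosep)
  moreover have "insert v ?N \<inter> (V - {v}) = ?N" using NV by auto
  ultimately show False using less by simp
qed

text \<open>\<open>P\<close>, the rest of \<open>C\<close> and the remaining vertices use pairwise
  disjoint sets of colours. So a connected monochromatic set lies in \<open>P\<close>, in
  \<open>C\<close> or in \<open>V'\<close>, and has order at most 2, \<open>k\<close> or
  \<open>k div 2\<close> respectively. The recursion on \<open>k\<close> enters as the hypothesis
  \<open>IH\<close>, with nothing precoloured.\<close>

lemma extendable_no_separation:
  fixes S :: "'c set"
  assumes "finite V" "E \<subseteq> V \<times> V" "sym E" "irrefl E" "4 \<le> card V"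
    and nosep: "\<And>A B. separation V E A B \<Longrightarrow> 3 \<le> card (A \<inter> B)"
    and circ: "\<And>xs. vcycle E xs \<Longrightarrow> length xs \<le> k"
    and P: "P \<subseteq> V" "card P \<le> 2" and S: "finite S" "k ^ 3 < 2 ^ (card S + 1)"
    and IH: "\<And>V' S' :: 'c set. \<lbrakk>4 \<le> k; V' \<subseteq> V; finite S'; (k div 2) ^ 3 < 2 ^ (card S' + 1);
      \<And>xs. vcycle (E \<inter> V' \<times> V') xs \<Longrightarrow> length xs \<le> k div 2\<rbrakk>
      \<Longrightarrow> extendable (k div 2) S' (E \<inter> V' \<times> V') V' {}"
  shows "extendable k S E V P"
  unfolding extendable_def
proof (intro allI impI)
  fix g :: "'a \<Rightarrow> 'c" assume g: "g ` P \<subseteq> S"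
  have "V \<noteq> {}" using assms(5) by auto
  then obtain xs0 where xs0: "vcycle E xs0" "4 \<le> length xs0"
    using vcycle_min_degree_3[OF assms(1-4)] degree_ge_3[OF assms(1-6)] by metis
  have k4: "4 \<le> k" using circ[OF xs0(1)] xs0(2) by linarith
  have "\<forall>xs. vcycle E xs \<longrightarrow> length xs < Suc k" using circ by (simp add: le_imp_less_Suc)
  then obtain C where C: "vcycle E C" and max: "\<And>xs. vcycle E xs \<Longrightarrow> length xs \<le> length C"
    using Lattices_Big.ex_has_greatest_nat[of "vcycle E" xs0 length] xs0(1) by blast
  have finP: "finite P" using P assms(1) finite_subset by auto
  have "card (g ` P) \<le> 2" using card_image_le[OF finP, of g] P(2) by linarith
  moreover have "card (S - g ` P) = card S - card (g ` P)" using g finP by (simp add: card_Diff_subset)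
  ultimately have cS: "card S - 2 \<le> card (S - g ` P)" by linarith
  \<comment> \<open>From \<open>4^3 = 2^6\<close> there are at least six colours, so some
    \<open>\<beta>\<close> does not occur on \<open>P\<close>.\<close>
  have "(4::nat) ^ 3 \<le> k ^ 3" using k4 by (rule power_mono) simp
  then have "(2::nat) ^ 6 < 2 ^ (card S + 1)" using S(2) by simp
  then have "6 < card S + 1" by (rule power_less_imp_less_exp[rotated]) simp
  then have "card (S - g ` P) \<noteq> 0" using cS by linarith
  then obtain \<beta> where \<beta>: "\<beta> \<in> S - g ` P" by (metis all_not_in_conv card.empty)
  define S' where "S' = S - g ` P - {\<beta>}"
  have "card S' = card (S - g ` P) - 1" unfolding S'_def using \<beta> S(1) by simp
  then have cS': "card S - 2 \<le> card S' + 1" using cS by linarith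
  \<comment> \<open>Halving \<open>k\<close> gains the factor \<open>8 = 2^3\<close>, worth three
    colours: up to two on \<open>P\<close>, and \<open>\<beta>\<close>. The exponent
    \<open>card S - 2\<close> is \<open>(card S - 3) + 1\<close>.\<close>
  have "8 * (k div 2) ^ 3 = (2 * (k div 2)) ^ 3" by (simp add: power_mult_distrib)
  also have "\<dots> \<le> k ^ 3" by (rule power_mono) auto
  also have "\<dots> < 2 ^ (card S + 1)" by (rule S(2))
  also have "\<dots> = 2 ^ (3 + (card S - 2))" using \<open>6 < card S + 1\<close> by (intro arg_cong[where f="power 2"]) linarith
  also have "\<dots> = 8 * 2 ^ (card S - 2)" by (simp add: power_add)
  finally have "(k div 2) ^ 3 < 2 ^ (card S - 2)" by simp
  also have "(2::nat) ^ (card S - 2) \<le> 2 ^ (card S' + 1)" using cS' by (rule power_increasing) simp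
  finally have pow: "(k div 2) ^ 3 < 2 ^ (card S' + 1)" .
  define V' where "V' = V - set C - P"
  let ?E' = "E \<inter> V' \<times> V'"
  have "length xs \<le> k div 2" if xs: "vcycle ?E' xs" for xs
  proof -
    have "vcycle E xs" using xs by (rule vcycle_mono) auto
    moreover have "set xs \<subseteq> V'" using xs by (rule vcycle_set_subset) auto
    then have "set C \<inter> set xs = {}" unfolding V'_def by auto
    ultimately have "2 * length xs \<le> length C"
      using disjoint_cycle_half[OF assms(1-3) nosep C max] by blast
    then show ?thesis using circ[OF C] by linarith
  qed
  then have "extendable (k div 2) S' ?E' V' {}"
    using k4 pow S(1) by (intro IH) (auto simp: V'_def S'_def)
  then obtain f' where "clustered_extension (k div 2) S' ?E' V' {} g f'"
    unfolding extendable_def by auto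
  note f' = clustered_extensionD(1,4)[OF this]
  define f where "f v = (if v \<in> P then g v else if v \<in> set C then \<beta> else f' v)" for v
  have f_P: "f v \<in> g ` P" if "v \<in> P" for v using that unfolding f_def by auto
  have f_C: "f v = \<beta>" if "v \<in> set C" "v \<notin> P" for v using that unfolding f_def by auto
  have f_V': "f v \<in> S'" "f v = f' v" if "v \<in> V'" for v using that f'(1) unfolding f_def V'_def by auto
  have f_nP: "f v \<notin> g ` P" if "v \<in> V" "v \<notin> P" for v
    using that f_C[of v] f_V'(1)[of v] \<beta> unfolding S'_def V'_def by (cases "v \<in> set C") auto
  have cW: "card W \<le> k" if W: "W \<subseteq> V" "conn_set E W" "\<And>u v. \<lbrakk>u \<in> W; v \<in> W\<rbrakk> \<Longrightarrow> f u = f v" for W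
  proof (cases "W \<inter> P = {}")
    case False
    then obtain p where p: "p \<in> W" "p \<in> P" by auto
    have "W \<subseteq> P"
    proof
      fix u assume u: "u \<in> W"
      show "u \<in> P" using f_nP[of u] f_P[OF p(2)] W(1) W(3)[OF u p(1)] u by auto
    qed
    then have "card W \<le> card P" using finP by (rule card_mono[rotated])
    then show ?thesis using P(2) k4 by linarith
  next
    case WP: True
    show ?thesis
    proof (cases "W \<inter> set C = {}")
      case False
      then obtain c where c: "c \<in> W" "c \<in> set C" by auto
      have "f c = \<beta>" using c WP by (intro f_C) auto
      have "W \<subseteq> set C"
      proof
        fix u assume u: "u \<in> W"
        have "f u = \<beta>" using W(3)[OF u c(1)] \<open>f c = \<beta>\<close> by simp
        then show "u \<in> set C" using f_V'(1)[of u] u W(1) WP unfolding S'_def V'_def by auto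
      qed
      then have "card W \<le> card (set C)" by (intro card_mono) auto
      also have "\<dots> \<le> length C" by (rule card_length)
      also have "\<dots> \<le> k" by (rule circ[OF C])
      finally show ?thesis .
    next
      case True
      then have WV': "W \<subseteq> V'" using W(1) WP unfolding V'_def by auto
      have "conn_set ?E' W" using W(2) by (rule conn_set_mono) (use WV' in auto)
      moreover have "f' u = f' v" if "u \<in> W" "v \<in> W" for u v
        using W(3)[OF that] f_V'(2)[OF subsetD[OF WV' that(1)]] f_V'(2)[OF subsetD[OF WV' that(2)]] by simp
      ultimately have "card W \<le> k div 2" by (rule f'(2)[OF WV'])
      then show ?thesis by linarith
    qed
  qed
  have "f u \<noteq> f p" if "p \<in> P" "u \<in> V - P" for p u
    using f_P[of p] f_nP[of u] that by auto
  moreover have "f ` V \<subseteq> S"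
    using g \<beta> f'(1) unfolding f_def S'_def V'_def by auto
  moreover have "f p = g p" if "p \<in> P" for p using that by (simp add: f_def)
  ultimately show "\<exists>f. clustered_extension k S E V P g f"
  proof (intro exI[of _ f] clustered_extensionI)
    show "card W \<le> k" if "W \<subseteq> V" "conn_set E W" "\<And>u v. \<lbrakk>u \<in> W; v \<in> W\<rbrakk> \<Longrightarrow> f u = f v" for W
      by (rule cW[OF that])
  qed auto
qed

section \<open>Separations of order at most two and the double induction\<close>

text \<open>If \<open>y\<close> were outside the component \<open>D\<close> of \<open>x\<close> in
  \<open>B\<close>, there would be a separation of order one: \<open>A\<close> against
  \<open>B - {x}\<close>, meeting in \<open>y\<close>, when \<open>D = {x}\<close>, and otherwise
  \<open>D\<close> against the rest of \<open>V\<close>, meeting in \<open>x\<close>. The interior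
  of a path in \<open>B\<close> avoids \<open>A\<close> because \<open>A\<close> meets
  \<open>B\<close> only in the two ends.\<close>

lemma separation_path:
  assumes "sym E" and sep: "separation V E A B" "A \<inter> B = {x, y}" "x \<noteq> y"
    and nosep: "\<And>A B. separation V E A B \<Longrightarrow> 2 \<le> card (A \<inter> B)"
  obtains q where "vwalk_in E (x # q @ [y])" "distinct (x # q @ [y])" "set q \<inter> A = {}"
proof -
  define D where "D = component_in E B x"
  have DB: "D \<subseteq> B" unfolding D_def by (rule component_in_subset)
  have xD: "x \<in> D" unfolding D_def using sep(2) by (intro component_in_self) auto
  have closed: "v \<in> D" if "u \<in> D" "v \<in> B" "(u, v) \<in> E" for u v
    using component_in_closed[OF assms(1)] that unfolding D_def by metis
  have xy: "x \<in> A" "x \<in> B" "y \<in> A" "y \<in> B" using sep(2) by auto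
  have "y \<in> D"
  proof (rule ccontr)
    assume yD: "y \<notin> D"
    show False
    proof (cases "D = {x}")
      case True
      have "separation V E A (B - {x})"
        using sep(1) xy closed True unfolding separation_def by blast
      then have "2 \<le> card (A \<inter> (B - {x}))" by (rule nosep)
      moreover have "A \<inter> (B - {x}) = {y}" using sep(2,3) by auto
      ultimately show False by simp
    next
      case False
      have "separation V E D (V - (D - {x}))" unfolding separation_def
      proof (intro conjI)
        show "D \<union> (V - (D - {x})) = V" using DB sep(1) unfolding separation_def by auto
        show "D - (V - (D - {x})) \<noteq> {}" using False xD by auto
        show "V - (D - {x}) - D \<noteq> {}" using yD xy sep(1) unfolding separation_def by auto
        show "E \<inter> (D - (V - (D - {x}))) \<times> (V - (D - {x}) - D) = {}"
        proof (rule ccontr)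
          assume "E \<inter> (D - (V - (D - {x}))) \<times> (V - (D - {x}) - D) \<noteq> {}"
          then obtain u v where uv: "(u, v) \<in> E" "u \<in> D" "u \<notin> V - (D - {x})" "v \<in> V" "v \<notin> D" by auto
          then have "u \<noteq> x" "u \<in> B" using DB sep(1) unfolding separation_def by auto
          then have "u \<in> B - A" using sep(2) yD uv(2) by auto
          moreover have "v \<notin> B" using closed uv by auto
          ultimately show False
            using sep(1) uv assms(1) unfolding separation_def by (blast dest: symD)
        qed
      qed
      then have "2 \<le> card (D \<inter> (V - (D - {x})))" by (rule nosep)
      moreover have "D \<inter> (V - (D - {x})) = {x}" using xD DB sep(1) unfolding separation_def by auto
      ultimately show False by simp
    qed
  qed
  have "conn_set E D" unfolding D_def by (rule conn_set_component_in)
  then obtain p where p: "p \<noteq> []" "distinct p" "vwalk_in E p" "set p \<subseteq> D" "hd p \<in> {x}" "last p \<in> {y}"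
    using conn_set_shortest_path[of E D "{x}" "{y}"] xD \<open>y \<in> D\<close> by blast
  obtain r where pr: "p = x # r" using p(1,5) by (cases p) auto
  have "r \<noteq> []" using p(6) sep(3) unfolding pr by auto
  then obtain q where r: "r = q @ [y]" using p(6) unfolding pr by (cases r rule: rev_cases) auto
  show thesis
  proof (rule that[of q])
    show "vwalk_in E (x # q @ [y])" "distinct (x # q @ [y])" using p unfolding pr r by auto
    then have "x \<notin> set q" "y \<notin> set q" by auto
    moreover have "set q \<subseteq> B" using p(4) DB unfolding pr r by auto
    then have "set q \<inter> A \<subseteq> {x, y}" unfolding sep(2)[symmetric] by auto
    ultimately show "set q \<inter> A = {}" by auto
  qed
qed

text \<open>The side containing \<open>P\<close> is coloured first, and the other one by extension
  from the separator. Hypothesis \<open>X\<close> treats a separator of at most one vertex and a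
  pair completed by a virtual edge alike.\<close>

lemma extendable_separation:
  assumes "sym E" and sep: "separation V E A B"
    and EA: "E \<inter> A \<times> A \<subseteq> EA" and EB: "E \<inter> B \<times> B \<subseteq> EB"
    and P: "P \<subseteq> V" "\<And>p q. \<lbrakk>p \<in> P; q \<in> P; p \<noteq> q\<rbrakk> \<Longrightarrow> (p, q) \<in> E"
    and X: "\<And>p q. \<lbrakk>p \<in> A \<inter> B; q \<in> A \<inter> B; p \<noteq> q\<rbrakk> \<Longrightarrow> (p, q) \<in> EA \<inter> EB"
    and c: "card P \<le> 2" "card (A \<inter> B) \<le> 2"
    and A: "\<And>Q. \<lbrakk>Q \<subseteq> A; card Q \<le> 2; \<And>p q. \<lbrakk>p \<in> Q; q \<in> Q; p \<noteq> q\<rbrakk> \<Longrightarrow> (p, q) \<in> EA\<rbrakk> \<Longrightarrow> extendable k S EA A Q"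
    and B: "\<And>Q. \<lbrakk>Q \<subseteq> B; card Q \<le> 2; \<And>p q. \<lbrakk>p \<in> Q; q \<in> Q; p \<noteq> q\<rbrakk> \<Longrightarrow> (p, q) \<in> EB\<rbrakk> \<Longrightarrow> extendable k S EB B Q"
  shows "extendable k S E V P"
  using separation_clique[OF sep P]
proof
  assume PA: "P \<subseteq> A"
  show ?thesis
  proof (rule extendable_glue[OF assms(1) sep EA EB PA])
    show "extendable k S EA A P" using P(2) PA EA c by (intro A) auto
    show "extendable k S EB B (A \<inter> B)" using X c by (intro B) auto
  qed
next
  assume PB: "P \<subseteq> B"
  show ?thesis
  proof (rule extendable_glue[OF assms(1) separation_commute[OF assms(1) sep] EB EA PB])
    show "extendable k S EB B P" using P(2) PB EB c by (intro B) auto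
    show "extendable k S EA A (B \<inter> A)" using X c by (intro A) (auto simp: Int_commute)
  qed
qed

text \<open>The bound on \<open>card S\<close> says \<open>\<lfloor>3 log\<^sub>2 k\<rfloor> \<le> card S\<close>; halving \<open>k\<close> frees three colours.\<close>

lemma extendable_circumference:
  fixes S :: "'c set"
  assumes "finite V" "E \<subseteq> V \<times> V" "sym E" "irrefl E" "2 \<le> k"
    and "\<And>xs. vcycle E xs \<Longrightarrow> length xs \<le> k"
    and "P \<subseteq> V" "card P \<le> 2" "\<And>p q. \<lbrakk>p \<in> P; q \<in> P; p \<noteq> q\<rbrakk> \<Longrightarrow> (p, q) \<in> E"
    and "finite S" "k ^ 3 < 2 ^ (card S + 1)"
  shows "extendable k S E V P"
  using assms
proof (induction k arbitrary: S E V P rule: less_induct)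
  case (less k)
  note IHk = less.IH
  \<comment> \<open>The inner induction keeps \<open>k\<close> and \<open>S\<close> fixed and passes
    to the smaller sides of a separation; the outer one is spent when \<open>k\<close> is
    halved.\<close>
  from less.prems show ?case
  proof (induction "card V" arbitrary: V E P rule: less_induct)
    case (less V)
    note fin = less.prems(1) and EV = less.prems(2) and sym = less.prems(3) and irr = less.prems(4)
      and k2 = less.prems(5) and circ = less.prems(6) and P = less.prems(7-9) and S = less.prems(10,11)
    have part: "finite A" "finite B" "card A < card V" "card B < card V" if "separation V E A B" for A B
    proof -
      have "A \<subset> V" "B \<subset> V" using that unfolding separation_def by auto
      then show "finite A" "finite B" "card A < card V" "card B < card V"
        using fin by (auto intro: psubset_card_mono finite_subset)
    qed
    \<comment> \<open>Order two is treated with smaller orders already excluded: this provides the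
      path through each side that stands in for the virtual edge.\<close>
    consider (one) A B where "separation V E A B" "card (A \<inter> B) \<le> 1"
      | (two) A B where "separation V E A B" "card (A \<inter> B) = 2"
          "\<And>A B. separation V E A B \<Longrightarrow> 2 \<le> card (A \<inter> B)"
      | (none) "\<And>A B. separation V E A B \<Longrightarrow> 3 \<le> card (A \<inter> B)"
    proof -
      assume *: "\<And>A B. \<lbrakk>separation V E A B; card (A \<inter> B) \<le> 1\<rbrakk> \<Longrightarrow> thesis"
        "\<And>A B. \<lbrakk>separation V E A B; card (A \<inter> B) = 2;
          \<And>A B. separation V E A B \<Longrightarrow> 2 \<le> card (A \<inter> B)\<rbrakk> \<Longrightarrow> thesis"
        "(\<And>A B. separation V E A B \<Longrightarrow> 3 \<le> card (A \<inter> B)) \<Longrightarrow> thesis"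
      show thesis
      proof (rule ccontr)
        assume no: "\<not> thesis"
        have ge2: "2 \<le> card (A \<inter> B)" if "separation V E A B" for A B using *(1)[OF that] no by linarith
        have "3 \<le> card (A \<inter> B)" if "separation V E A B" for A B
        proof -
          have "card (A \<inter> B) \<noteq> 2" using *(2)[OF that _ ge2] no by blast
          then show ?thesis using ge2[OF that] by linarith
        qed
        then show False using *(3) no by blast
      qed
    qed
    then show ?case
    proof cases
      case one
      have IH: "extendable k S (E \<inter> A' \<times> A') A' Q"
        if "finite A'" "card A' < card V" "Q \<subseteq> A'" "card Q \<le> 2"
          "\<And>p q. \<lbrakk>p \<in> Q; q \<in> Q; p \<noteq> q\<rbrakk> \<Longrightarrow> (p, q) \<in> E \<inter> A' \<times> A'" for A' Q
      proof (rule less.hyps[OF that(2,1)])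
        show "sym (E \<inter> A' \<times> A')" using sym unfolding sym_def by auto
        show "irrefl (E \<inter> A' \<times> A')" using irr unfolding irrefl_def by auto
        show "length xs \<le> k" if "vcycle (E \<inter> A' \<times> A') xs" for xs
          using circ vcycle_mono[OF that, of E] by auto
      qed (use that k2 S in auto)
      have finX: "finite (A \<inter> B)" using part[OF one(1)] by auto
      have eq: "p = q" if "p \<in> A \<inter> B" "q \<in> A \<inter> B" for p q
        using that one(2) finX card_le_Suc0_iff_eq[OF finX] by auto
      show ?thesis
        by (rule extendable_separation[OF sym one(1) order_refl order_refl P(1,3)])
          (use one(2) P eq part[OF one(1)] in \<open>auto intro!: IH\<close>)
    next
      case two
      obtain x y where xy: "A \<inter> B = {x, y}" "x \<noteq> y" using two(2) by (meson card_2_iff)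
      \<comment> \<open>For adjacent \<open>x\<close> and \<open>y\<close> this adds nothing, so
        adjacent and nonadjacent pairs need no distinction.\<close>
      let ?E = "\<lambda>A'. E \<inter> A' \<times> A' \<union> {(x, y), (y, x)}"
      have IH: "extendable k S (?E A') A' Q"
        if A': "finite A'" "card A' < card V" "x \<in> A'" "y \<in> A'"
          and q: "vwalk_in E (x # q @ [y])" "distinct (x # q @ [y])" "set q \<inter> A' = {}"
          and Q: "Q \<subseteq> A'" "card Q \<le> 2" "\<And>p q. \<lbrakk>p \<in> Q; q \<in> Q; p \<noteq> q\<rbrakk> \<Longrightarrow> (p, q) \<in> ?E A'" for A' Q q
      proof (rule less.hyps[OF A'(2,1)])
        show "sym (?E A')" using sym unfolding sym_def by auto
        show "irrefl (?E A')" using irr xy(2) unfolding irrefl_def by auto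
        show "length xs \<le> k" if "vcycle (?E A') xs" for xs
          by (rule vcycle_virtual_edge_bound[OF sym circ q A'(3,4) that])
      qed (use A' Q k2 S in auto)
      have xyA: "x \<in> A" "y \<in> A" "x \<in> B" "y \<in> B" using xy by auto
      obtain q where q: "vwalk_in E (x # q @ [y])" "distinct (x # q @ [y])" "set q \<inter> A = {}"
        using separation_path[OF sym two(1) xy two(3)] by blast
      have xy': "B \<inter> A = {x, y}" using xy by auto
      obtain q' where q': "vwalk_in E (x # q' @ [y])" "distinct (x # q' @ [y])" "set q' \<inter> B = {}"
        using separation_path[OF sym separation_commute[OF sym two(1)] xy' xy(2) two(3)] by blast
      show ?thesis
      proof (rule extendable_separation[OF sym two(1) _ _ P(1,3)])
        show "extendable k S (?E A) A Q" if "Q \<subseteq> A" "card Q \<le> 2"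
          "\<And>p q. \<lbrakk>p \<in> Q; q \<in> Q; p \<noteq> q\<rbrakk> \<Longrightarrow> (p, q) \<in> ?E A" for Q
          by (rule IH[OF _ _ xyA(1,2) q that]) (use part[OF two(1)] in auto)
        show "extendable k S (?E B) B Q" if "Q \<subseteq> B" "card Q \<le> 2"
          "\<And>p q. \<lbrakk>p \<in> Q; q \<in> Q; p \<noteq> q\<rbrakk> \<Longrightarrow> (p, q) \<in> ?E B" for Q
          by (rule IH[OF _ _ xyA(3,4) q' that]) (use part[OF two(1)] in auto)
      qed (use xy two(2) P in auto)
    next
      case none
      \<comment> \<open>Complete graphs on at most three vertices have no separation, yet their
        degrees are below three, so they are coloured directly; \<open>2^3 <= k^3\<close> provides
        the three colours.\<close>
      show ?thesis
      proof (cases "card V \<le> 3")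
        case True
        have "(2::nat) ^ 3 \<le> k ^ 3" using k2 by (rule power_mono) simp
        then have "(2::nat) ^ 3 < 2 ^ (card S + 1)" using S(2) by linarith
        then have "3 < card S + 1" by (rule power_less_imp_less_exp[rotated]) simp
        then show ?thesis using True fin P k2 S by (intro extendable_small) auto
      next
        case False
        show ?thesis
        proof (rule extendable_no_separation[OF fin EV sym irr _ none circ P(1,2) S])
          fix V' and S' :: "'c set"
          assume a: "4 \<le> k" "V' \<subseteq> V" "finite S'" "(k div 2) ^ 3 < 2 ^ (card S' + 1)"
            "\<And>xs. vcycle (E \<inter> V' \<times> V') xs \<Longrightarrow> length xs \<le> k div 2"
          show "extendable (k div 2) S' (E \<inter> V' \<times> V') V' {}"
          proof (rule IHk)
            show "finite V'" using a(2) fin finite_subset by auto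
            show "sym (E \<inter> V' \<times> V')" using sym unfolding sym_def by auto
            show "irrefl (E \<inter> V' \<times> V')" using irr unfolding irrefl_def by auto
          qed (use a in auto)
        qed (use False in auto)
      qed
    qed
  qed
qed

section \<open>Digraph formulation\<close>

lemma (in wf_digraph) vwalk_in_arcs_ends_awalk:
  assumes "vwalk_in (arcs_ends G) xs" "xs \<noteq> []"
  obtains p where "set p \<subseteq> arcs G" "cas (hd xs) p (last xs)" "awalk_verts (hd xs) p = xs"
  using assms
proof (induction xs arbitrary: thesis)
  case (Cons x xs)
  show ?case
  proof (cases "xs = []")
    case True
    then show ?thesis by (intro Cons.prems(1)[of "[]"]) auto
  next
    case False
    then obtain p where p: "set p \<subseteq> arcs G" "cas (hd xs) p (last xs)" "awalk_verts (hd xs) p = xs"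
      using Cons.IH Cons.prems(2) by (auto simp: vwalk_in_Cons)
    obtain e where "e \<in> arcs G" "tail G e = x" "head G e = hd xs"
      using Cons.prems(2) False by (auto simp: vwalk_in_Cons arcs_ends_def arc_to_ends_def)
    then show ?thesis using p False by (intro Cons.prems(1)[of "e # p"]) auto
  qed
qed simp

lemma (in wf_digraph) vcycle_imp_graph_cycle:
  assumes "vcycle (arcs_ends G) xs"
  obtains p where "graph_cycle G p" "length p = length xs"
proof -
  have ne: "xs \<noteq> []" using assms by (auto simp: vcycle_def)
  \<comment> \<open>The vertex list of a closed arc walk contains its starting vertex at both ends.
    Repeating \<open>hd xs\<close> thus gives as many arcs as \<open>xs\<close> has
    vertices.\<close>
  have "vwalk_in (arcs_ends G) (xs @ [hd xs])"
    using assms by (auto simp: vcycle_def vwalk_in_append vwalk_in_Cons)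
  then obtain p where p: "set p \<subseteq> arcs G" "cas (hd xs) p (hd xs)" "awalk_verts (hd xs) p = xs @ [hd xs]"
    using vwalk_in_arcs_ends_awalk[of "xs @ [hd xs]"] ne by (auto simp: hd_append)
  have len: "length p = length xs" using arg_cong[OF p(3), of length] by (simp add: length_awalk_verts)
  have "arcs_ends G \<subseteq> verts G \<times> verts G" by (auto simp: arcs_ends_def arc_to_ends_def)
  then have "hd xs \<in> verts G" using vcycle_set_subset[OF assms] ne by (meson hd_in_set subsetD)
  then have "cycle p"
    unfolding cycle_def using assms p ne len
    by (intro exI[of _ "hd xs"]) (cases xs; auto simp: awalk_def vcycle_def)
  then show thesis using assms len by (intro that[of p]) (auto simp: graph_cycle_def vcycle_def)
qed

text \<open>\<open>Max\<close> yields an upper bound only on a finite set. The heads of the arcs of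
  a cycle are distinct, so its length is at most \<open>card (verts G)\<close>.\<close>

lemma (in fin_digraph) graph_cycle_length_le_circumference:
  assumes "graph_cycle G p"
  shows "length p \<le> circumference G"
proof -
  have "length q \<le> card (verts G)" if "graph_cycle G q" for q
  proof -
    obtain u where u: "awalk u q u" "distinct (tl (awalk_verts u q))"
      using \<open>graph_cycle G q\<close> unfolding graph_cycle_def cycle_def by auto
    have "u \<in> verts G" "set q \<subseteq> arcs G" using u(1) unfolding awalk_def by blast+
    then have "set (awalk_verts u q) \<subseteq> verts G" using awalk_verts_in_verts by blast
    then have "set (tl (awalk_verts u q)) \<subseteq> verts G" by (cases "awalk_verts u q") auto
    then have "card (set (tl (awalk_verts u q))) \<le> card (verts G)" by (intro card_mono) auto
    then show ?thesis using u(2) by (simp add: distinct_card length_awalk_verts)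
  qed
  then have "{length p | p. graph_cycle G p} \<subseteq> {..card (verts G)}" by auto
  then have "finite {length p | p. graph_cycle G p}" by (rule finite_subset) simp
  then show ?thesis using assms unfolding circumference_def by (auto intro: Max_ge)
qed

text \<open>\<open>Digraph_Component.connected H\<close> means that \<open>mk_symmetric H\<close> is
  strongly connected. The arcs reversed there are still edges of \<open>G\<close> because
  \<open>G\<close> is symmetric, so reachability from a vertex of \<open>D\<close> never leaves
  \<open>D\<close>.\<close>

lemma conn_set_connected_subgraph:
  assumes "symmetric G" "subgraph H G" "Digraph_Component.connected H"
  shows "conn_set (arcs_ends G) (verts H)"
proof (rule conn_setI)
  fix D assume D: "D \<inter> verts H \<noteq> {}"
    and cl: "\<And>u v. \<lbrakk>u \<in> D; u \<in> verts H; v \<in> verts H; (u, v) \<in> arcs_ends G\<rbrakk> \<Longrightarrow> v \<in> D"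
  interpret H: wf_digraph H using assms(2) by (auto simp: subgraph_def)
  interpret S: pair_wf_digraph "mk_symmetric H" by (rule H.wellformed_mk_symmetric)
  obtain a where a: "a \<in> D" "a \<in> verts H" using D by auto
  have arcs: "(u, v) \<in> arcs_ends G" if "(u, v) \<in> parcs (mk_symmetric H)" for u v
  proof -
    have "(u, v) \<in> arcs_ends H \<or> (v, u) \<in> arcs_ends H"
      using that by (auto simp: mk_symmetric_def arcs_ends_def arc_to_ends_def image_iff)
    moreover have "arcs_ends H \<subseteq> arcs_ends G"
      using assms(2) by (auto simp: subgraph_def compatible_def arcs_ends_def arc_to_ends_def)
    ultimately show ?thesis using assms(1) by (auto simp: symmetric_def dest: symD)
  qed
  show "verts H \<subseteq> D"
  proof
    fix v assume "v \<in> verts H"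
    then have "a \<rightarrow>\<^sup>*\<^bsub>with_proj (mk_symmetric H)\<^esub> v"
      using assms(3) a(2) by (auto simp: connected_def strongly_connected_def mk_symmetric_def)
    then show "v \<in> D"
    proof (induction rule: S.reachable_induct)
      case base
      show ?case by (rule a(1))
    next
      case (step x y)
      have "x \<in> verts H" "y \<in> verts H"
        using step.hyps S.arc_fst_in_verts[of "(x, y)"] S.arc_snd_in_verts[of "(x, y)"]
        by (auto simp: mk_symmetric_def)
      then show ?case using step arcs by (intro cl[of x y]) auto
    qed
  qed
qed

theorem theorem1:
  fixes k :: nat and G :: "('a, 'b) pre_digraph"
  assumes "k \<ge> 2"
    and "graph G"
    and "circumference G \<le> k"
  shows "\<exists>c f. real c \<le> 3 * log 2 (real k) \<and> colouring G c f \<and>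
    (\<forall>H. monochromatic_component G f H \<longrightarrow> card (verts H) \<le> k)"
proof -
  interpret graph G by (rule assms(2))
  \<comment> \<open>The largest admissible number of colours. Rounding down gives
    \<open>3 log k < c + 1\<close>, which turns into the integer inequality
    \<open>k^3 < 2^(c + 1)\<close> carried by the induction.\<close>
  define c where "c = nat \<lfloor>3 * log 2 (real k)\<rfloor>"
  have "0 \<le> log 2 (real k)" using assms(1) by simp
  then have c: "real c \<le> 3 * log 2 (real k)" "3 * log 2 (real k) < real (c + 1)"
    unfolding c_def by linarith+
  have "log 2 (real k ^ 3) = 3 * log 2 (real k)" using assms(1) by (simp add: log_nat_power)
  then have "log 2 (real k ^ 3) < real (c + 1)" using c(2) by simp
  then have "real k ^ 3 < 2 powr real (c + 1)" using assms(1) by (subst (asm) log_less_iff) auto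
  then have "real (k ^ 3) < real (2 ^ (c + 1))" by (simp add: powr_realpow[symmetric] powr_add)
  then have pow: "k ^ 3 < 2 ^ (c + 1)" by (simp only: of_nat_less_iff)
  have E: "arcs_ends G \<subseteq> verts G \<times> verts G" "irrefl (arcs_ends G)"
    using no_loops by (auto simp: arcs_ends_def arc_to_ends_def irrefl_def)
  have symE: "sym (arcs_ends G)" using sym_arcs by (simp add: symmetric_def)
  have circ: "length xs \<le> k" if "vcycle (arcs_ends G) xs" for xs
    using vcycle_imp_graph_cycle[OF that] graph_cycle_length_le_circumference assms(3) by (metis le_trans)
  \<comment> \<open>The theorem is the case of the strengthened claim in which no vertex is
    precoloured.\<close>
  have "extendable k {..<c} (arcs_ends G) (verts G) {}"
    by (rule extendable_circumference[OF finite_verts E(1) symE E(2) assms(1) circ]) (use pow in auto)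
  then obtain f where "clustered_extension k {..<c} (arcs_ends G) (verts G) {} (\<lambda>_. 0) f"
    unfolding extendable_def by auto
  note f = clustered_extensionD(1,4)[OF this]
  have "card (verts H) \<le> k" if mono: "monochromatic_component G f H" for H
  proof -
    obtain i where "graph_component H (G \<restriction> {v \<in> verts G. f v = i})"
      using mono unfolding monochromatic_component_def by auto
    then have H: "subgraph H (G \<restriction> {v \<in> verts G. f v = i})" "Digraph_Component.connected H"
      unfolding graph_component_def pre_digraph.max_subgraph_def by auto
    have vH: "verts H \<subseteq> {v \<in> verts G. f v = i}" using H(1) by (auto simp: subgraph_def)
    have "subgraph H G" using H(1) wf_digraph_axioms
      by (auto simp: subgraph_def compatible_def induce_subgraph_def)
    then have "conn_set (arcs_ends G) (verts H)"
      by (rule conn_set_connected_subgraph[OF sym_arcs _ H(2)])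
    moreover have "f u = f v" if "u \<in> verts H" "v \<in> verts H" for u v using vH that by auto
    moreover have "verts H \<subseteq> verts G" using vH by auto
    ultimately show ?thesis by (intro f(2))
  qed
  moreover have "colouring G c f" using f(1) by (auto simp: colouring_def)
  ultimately show ?thesis using c(1) by blast
qed

end
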